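(* The uniformity of the class of non-computably-dominated functions to the class of $2$-random sets is $2$. That is, with $\mathcal{A}$ the class of functions that are not computably dominated and $\mathcal{B}$ the class of $2$-random sets, we have $\mathcal{A}\leq_2\mathcal{B}$, but $\mathcal{A}\not\leq_0\mathcal{B}$ and $\mathcal{A}\not\leq_1\mathcal{B}$.
   Context: $\Phi_e$ is the Turing functional with index $e$; writing $\Phi_e(f)\in\mathcal{A}$ means in particular that $\Phi_e(f)$ is total. $\Pi^0_n$-classes are the effective (lightface) $\Pi^0_n$ subsets of $\omega^\omega$; a sequence of classes is uniformly $\Pi^0_n$ if it has a computable sequence of $\Pi^0_n$-indices. For $n=0$, $\Pi^0_0$-classes are finite Boolean combinations of cylinders $\{f \mid \sigma\subset f\}$, $\sigma\in\omega^{<\omega}$. For $n\in\omega$ and $\mathcal{A},\mathcal{B}\subseteq\omega^\omega$, $\mathcal{A}\leq_n\mathcal{B}$ means: there are a uniformly $\Pi^0_n$ sequence $\mathcal{V}_0,\mathcal{V}_1,\dots$ with $\mathcal{B}\subseteq\bigcup_i\mathcal{V}_i$ and a computable sequence $e_0,e_1,\dots$ such that for every $i$ and every $f\in\mathcal{B}\cap\mathcal{V}_i$ we have $\Phi_{e_i}(f)\in\mathcal{A}$. $\leq_\omega$ denotes Muchnik reducibility (every $f\in\mathcal{B}$ computes some $g\in\mathcal{A}$). If $\mathcal{A}$ Muchnik-reduces to $\mathcal{B}$, the uniformity of $\mathcal{A}$ to $\mathcal{B}$ is the least $n\in\omega+1$ with $\mathcal{A}\leq_n\mathcal{B}$. A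 function $f\in\omega^\omega$ is computably dominated if there is a computable $g$ with $f(k)\leq g(k)$ for all $k$. A set $X\in2^\omega$ is $2$-random if it is Martin-Löf random relative to $\emptyset'$. *)

theory Defs
  imports "HOL-Probability.Probability" "HOL-Library.Nat_Bijection" "HOL-Library.Extended_Nat"
begin

section \<open>Turing functionals\<close>

text \<open>
  Oracle programs denote partial unary functions on the natural numbers; tuples are passed through
  the Cantor pairing function \<open>prod_encode\<close>.  These are the usual partial recursive functions
  (basic functions, pairing, composition, primitive recursion, unbounded search), with one extra
  basic function that queries the oracle.
\<close>

datatype prog =
    PZero
  | PSucc
  | PFst
  | PSnd
  | POracle
  | PPair prog prog
  | PComp prog prog
  | PRec prog prog
  | PMin prog

inductive eval :: "(nat \<Rightarrow> nat) \<Rightarrow> prog \<Rightarrow> nat \<Rightarrow> nat \<Rightarrow> bool" for f :: "nat \<Rightarrow> nat" where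
  Zero: "eval f PZero x 0"
| Succ: "eval f PSucc x (Suc x)"
| Fst: "eval f PFst x (fst (prod_decode x))"
| Snd: "eval f PSnd x (snd (prod_decode x))"
| Oracle: "eval f POracle x (f x)"
| Pair: "eval f p x y \<Longrightarrow> eval f q x z \<Longrightarrow> eval f (PPair p q) x (prod_encode (y, z))"
| Comp: "eval f q x y \<Longrightarrow> eval f p y z \<Longrightarrow> eval f (PComp p q) x z"
| Rec_0: "eval f p a y \<Longrightarrow> eval f (PRec p q) (prod_encode (a, 0)) y"
| Rec_Suc: "eval f (PRec p q) (prod_encode (a, n)) y \<Longrightarrow>
    eval f q (prod_encode (a, prod_encode (n, y))) z \<Longrightarrow>
    eval f (PRec p q) (prod_encode (a, Suc n)) z"
| Min: "eval f p (prod_encode (a, n)) 0 \<Longrightarrow>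
    (\<forall>m<n. \<exists>y>0. eval f p (prod_encode (a, m)) y) \<Longrightarrow>
    eval f (PMin p) a n"

lemma eval_deterministic: "eval f p x y \<Longrightarrow> eval f p x z \<Longrightarrow> y = z"
proof (induction arbitrary: z rule: eval.induct)
  case (Pair p x y q y')
  from Pair.prems show ?case
    by cases (auto dest: Pair.IH)
next
  case (Comp q x y p y')
  from Comp.prems show ?case
    by cases (auto dest: Comp.IH)
next
  case (Rec_0 p a y q)
  from Rec_0.prems show ?case
    by cases (auto dest: Rec_0.IH)
next
  case (Rec_Suc p q a n y y')
  from Rec_Suc.prems show ?case
    by cases (auto dest: Rec_Suc.IH)
next
  case (Min p a n)
  from Min.prems have z: "eval f p (prod_encode (a, z)) 0"
    "\<forall>m<z. \<exists>y>0. eval f p (prod_encode (a, m)) y"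
    by (cases; simp)+
  have "\<not> n < z"
    using z(2) Min.IH(1) by blast
  moreover have "\<not> z < n"
    using z(1) Min.IH(2) by blast
  ultimately show ?case by simp
qed (erule eval.cases; simp)+

primrec prog_index :: "prog \<Rightarrow> nat" where
  "prog_index PZero = 0"
| "prog_index PSucc = 1"
| "prog_index PFst = 2"
| "prog_index PSnd = 3"
| "prog_index POracle = 4"
| "prog_index (PPair p q) = 4 * prod_encode (prog_index p, prog_index q) + 5"
| "prog_index (PComp p q) = 4 * prod_encode (prog_index p, prog_index q) + 6"
| "prog_index (PRec p q) = 4 * prod_encode (prog_index p, prog_index q) + 7"
| "prog_index (PMin p) = 4 * prog_index p + 8"

lemma inj_prog_index: "inj prog_index"
proof (rule injI)
  have mod4: "(4 * a + i = 4 * b + j) \<longleftrightarrow> (a = b \<and> i = j)"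
    if "i \<in> {5, 6, 7, 8}" "j \<in> {5, 6, 7, 8}" for a b i j :: nat
    using that by auto presburger+
  show "prog_index p = prog_index q \<Longrightarrow> p = q" for p q
  proof (induction p arbitrary: q)
    case (PPair p1 p2)
    then show ?case by (cases q) (simp_all add: mod4)
  next
    case (PComp p1 p2)
    then show ?case by (cases q) (simp_all add: mod4)
  next
    case (PRec p1 p2)
    then show ?case by (cases q) (simp_all add: mod4)
  next
    case (PMin p)
    then show ?case by (cases q) (simp_all add: mod4)
  qed (case_tac q; simp)+
qed

text \<open>\<open>Phi e f x y\<close> says that \<open>\<Phi>\<^sub>e(f)(x)\<close> converges with value \<open>y\<close>.\<close>

definition Phi :: "nat \<Rightarrow> (nat \<Rightarrow> nat) \<Rightarrow> nat \<Rightarrow> nat \<Rightarrow> bool" where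
  "Phi e f x y \<longleftrightarrow> (\<exists>p. prog_index p = e \<and> eval f p x y)"

text \<open>\<open>Phi_total e f g\<close> says that \<open>\<Phi>\<^sub>e(f)\<close> is total and equal to \<open>g\<close>.\<close>

definition Phi_total :: "nat \<Rightarrow> (nat \<Rightarrow> nat) \<Rightarrow> (nat \<Rightarrow> nat) \<Rightarrow> bool" where
  "Phi_total e f g \<longleftrightarrow> (\<forall>x. Phi e f x (g x))"

definition computable_in :: "(nat \<Rightarrow> nat) \<Rightarrow> (nat \<Rightarrow> nat) \<Rightarrow> bool" where
  "computable_in f g \<longleftrightarrow> (\<exists>e. Phi_total e f g)"

definition computable :: "(nat \<Rightarrow> nat) \<Rightarrow> bool" where
  "computable g \<longleftrightarrow> computable_in (\<lambda>_. 0) g"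

definition ce_set :: "(nat \<Rightarrow> nat) \<Rightarrow> nat \<Rightarrow> nat set" where
  "ce_set f e = {x. \<exists>y. Phi e f x y}"


section \<open>Effective classes\<close>

datatype bool_comb =
    BCylinder "nat list"
  | BCompl bool_comb
  | BInter bool_comb bool_comb

primrec bool_comb_class :: "bool_comb \<Rightarrow> (nat \<Rightarrow> nat) set" where
  "bool_comb_class (BCylinder s) = {f. map f [0..<length s] = s}"
| "bool_comb_class (BCompl b) = - bool_comb_class b"
| "bool_comb_class (BInter b c) = bool_comb_class b \<inter> bool_comb_class c"

primrec bool_comb_index :: "bool_comb \<Rightarrow> nat" where
  "bool_comb_index (BCylinder s) = 3 * list_encode s"
| "bool_comb_index (BCompl b) = 3 * bool_comb_index b + 1"
| "bool_comb_index (BInter b c) = 3 * prod_encode (bool_comb_index b, bool_comb_index c) + 2"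

lemma inj_bool_comb_index: "inj bool_comb_index"
proof (rule injI)
  have mod3: "(3 * a + i = 3 * b + j) \<longleftrightarrow> (a = b \<and> i = j)"
    if "i < 3" "j < 3" for a b i j :: nat
    using that by presburger
  show "bool_comb_index b = bool_comb_index c \<Longrightarrow> b = c" for b c
  proof (induction b arbitrary: c)
    case (BCylinder s)
    then show ?case
      using mod3[of 0 1] mod3[of 0 2] by (cases c) (auto dest: injD[OF inj_list_encode])
  next
    case (BCompl b)
    then show ?case
      using mod3[of 1 0] mod3[of 1 2] by (cases c) auto
  next
    case (BInter b1 b2)
    then show ?case
      using mod3[of 2 0] mod3[of 2 1] by (cases c) auto
  qed
qed

text \<open>
  \<open>Pi_class n e\<close> is the \<open>\<Pi>\<^sup>0\<^sub>n\<close>-class with index \<open>e\<close>.  A \<open>\<Sigma>\<^sup>0\<^sub>n\<^sub>+\<^sub>1\<close>-class is the union of the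
  \<open>\<Pi>\<^sup>0\<^sub>n\<close>-classes whose indices are taken from some c.e. set, and a \<open>\<Pi>\<^sup>0\<^sub>n\<^sub>+\<^sub>1\<close>-class is the complement
  of a \<open>\<Sigma>\<^sup>0\<^sub>n\<^sub>+\<^sub>1\<close>-class.
\<close>

primrec Pi_class :: "nat \<Rightarrow> nat \<Rightarrow> (nat \<Rightarrow> nat) set" where
  "Pi_class 0 e = {f. \<exists>b. bool_comb_index b = e \<and> f \<in> bool_comb_class b}"
| "Pi_class (Suc n) e = - (\<Union>d \<in> ce_set (\<lambda>_. 0) e. Pi_class n d)"

definition uniformly_Pi :: "nat \<Rightarrow> (nat \<Rightarrow> (nat \<Rightarrow> nat) set) \<Rightarrow> bool" where
  "uniformly_Pi n V \<longleftrightarrow> (\<exists>h. computable h \<and> (\<forall>i. V i = Pi_class n (h i)))"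


section \<open>Levels of uniformity\<close>

definition reducible_fin :: "nat \<Rightarrow> (nat \<Rightarrow> nat) set \<Rightarrow> (nat \<Rightarrow> nat) set \<Rightarrow> bool" where
  "reducible_fin n A B \<longleftrightarrow>
     (\<exists>V e. uniformly_Pi n V \<and> B \<subseteq> (\<Union>i. V i) \<and> computable e \<and>
        (\<forall>i. \<forall>f \<in> B \<inter> V i. \<exists>g \<in> A. Phi_total (e i) f g))"

definition muchnik_reducible :: "(nat \<Rightarrow> nat) set \<Rightarrow> (nat \<Rightarrow> nat) set \<Rightarrow> bool" where
  "muchnik_reducible A B \<longleftrightarrow> (\<forall>f \<in> B. \<exists>g \<in> A. computable_in f g)"

text \<open>The ordinal \<open>\<omega> + 1\<close> is represented by \<open>enat\<close>, with \<open>\<infinity>\<close> in the role of \<open>\<omega>\<close>.\<close>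

definition reducible :: "enat \<Rightarrow> (nat \<Rightarrow> nat) set \<Rightarrow> (nat \<Rightarrow> nat) set \<Rightarrow> bool" where
  "reducible n A B = (case n of enat m \<Rightarrow> reducible_fin m A B | \<infinity> \<Rightarrow> muchnik_reducible A B)"

text \<open>Meaningful only if \<open>muchnik_reducible A B\<close>; otherwise the minimum is over the empty set.\<close>

definition uniformity_level :: "(nat \<Rightarrow> nat) set \<Rightarrow> (nat \<Rightarrow> nat) set \<Rightarrow> enat" where
  "uniformity_level A B = (LEAST n. reducible n A B)"


section \<open>Computable domination and randomness\<close>

definition computably_dominated :: "(nat \<Rightarrow> nat) \<Rightarrow> bool" where
  "computably_dominated f \<longleftrightarrow> (\<exists>g. computable g \<and> (\<forall>k. f k \<le> g k))"

definition char_fun :: "(nat \<Rightarrow> bool) \<Rightarrow> nat \<Rightarrow> nat" where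
  "char_fun X k = of_bool (X k)"

definition fair_coin :: "(nat \<Rightarrow> bool) measure" where
  "fair_coin = PiM UNIV (\<lambda>_. measure_pmf (bernoulli_pmf (1/2)))"

text \<open>
  The \<open>n\<close>-th component of the uniformly \<open>\<Sigma>\<^sup>0\<^sub>1(Z)\<close> sequence of subsets of \<open>2\<^sup>\<omega>\<close> with index \<open>e\<close>:
  the union of the cylinders given by the binary strings \<open>\<sigma>\<close> with \<open>(n, \<sigma>)\<close> in the set \<open>ce_set Z e\<close>,
  which is c.e. in \<open>Z\<close>.
\<close>

definition Sigma1_seq :: "(nat \<Rightarrow> nat) \<Rightarrow> nat \<Rightarrow> nat \<Rightarrow> (nat \<Rightarrow> bool) set" where
  "Sigma1_seq Z e n =
     {X. \<exists>k. prod_encode (n, list_encode (map (char_fun X) [0..<k])) \<in> ce_set Z e}"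

definition martin_loef_test :: "(nat \<Rightarrow> nat) \<Rightarrow> (nat \<Rightarrow> (nat \<Rightarrow> bool) set) \<Rightarrow> bool" where
  "martin_loef_test Z U \<longleftrightarrow>
     (\<exists>e. U = Sigma1_seq Z e) \<and> (\<forall>n. emeasure fair_coin (U n) \<le> ennreal ((1/2) ^ n))"

definition martin_loef_random :: "(nat \<Rightarrow> nat) \<Rightarrow> (nat \<Rightarrow> bool) \<Rightarrow> bool" where
  "martin_loef_random Z X \<longleftrightarrow> (\<forall>U. martin_loef_test Z U \<longrightarrow> X \<notin> (\<Inter>n. U n))"

definition halting_problem :: "nat \<Rightarrow> bool" where
  "halting_problem e \<longleftrightarrow> e \<in> ce_set (\<lambda>_. 0) e"

definition two_random :: "(nat \<Rightarrow> bool) \<Rightarrow> bool" where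
  "two_random X \<longleftrightarrow> martin_loef_random (char_fun halting_problem) X"

definition non_computably_dominated :: "(nat \<Rightarrow> nat) set" where
  "non_computably_dominated = {f. \<not> computably_dominated f}"

definition two_randoms :: "(nat \<Rightarrow> nat) set" where
  "two_randoms = {char_fun X | X. two_random X}"

end

(*
  Level 1 fails by compactness.  If a Pi^0_1 class V of positive measure is mapped by a functional
  Phi to functions that are total for 2-random arguments, then for each k almost every X either
  leaves V or makes Phi^X(k) converge, and both events are enumerable.  By counting strings one
  computes a bound g(k) such that outside measure 2^-(k+c) this happens within g(k).  As the sum of
  these errors can be made smaller than the measure of V, some 2-random X in V has Phi(X) <= g.

  Level 2 is Martin's waiting argument.  Fix b.  For each e split Cantor space into 2^(e+b+1) parts
  by the first e+b+1 bits.  The parts wait one after the other for a computation phi_e(<e,n>) to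
  halt, and the values of f_b^X on the waiting part exceed phi_e there.  If phi_e is total, every
  part gets its turn, so f_b^X escapes phi_e.  Otherwise at most one part waits forever.  Hence the
  set of X for which f_b^X is partial is Sigma^0_1 in the halting problem and has measure at most
  2^-b, and every 2-random X lies in the Pi^0_2 class of total f_b^X for some b.
*)
theory Submission imports Defs begin

section \<open>Total recursive functionals\<close>

text \<open>Evaluation is only an inductive relation, so halting must first be given a decidable
  matrix: finite certificates, coded by numbers, take the role of Kleene's T predicate, and the
  partial programs built later are unbounded searches over decidable conditions. A search witness
  exceeds the value it certifies. This inequality turns a bound on witnesses into a bound on values
  at level 1, and it lets the functional at level 2 output a witness in place of a value. At level 1
  the functional may diverge off the class, so its own halting time has no usable bound. Racing it
  against the enumeration of the complement gives a search that halts almost everywhere, and for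
  such a search the counting of strings always succeeds. At level 2 the splitting keeps waiting
  affordable: if every sequence waited for every \<open>e\<close>, a single partial function would
  make the output partial everywhere. The lengths \<open>e + b + 1\<close> make the losses over all
  \<open>e\<close> sum to \<open>(1/2) ^ b\<close>.\<close>

abbreviation \<pi>1 :: "nat \<Rightarrow> nat" where "\<pi>1 z \<equiv> fst (prod_decode z)"
abbreviation \<pi>2 :: "nat \<Rightarrow> nat" where "\<pi>2 z \<equiv> snd (prod_decode z)"

text \<open>One program has to serve all oracles and converge everywhere. Predicates enter through
  \<open>of_bool\<close>, so the same notion covers decidability relative to an oracle.\<close>

definition recfn :: "((nat \<Rightarrow> nat) \<Rightarrow> nat \<Rightarrow> nat) \<Rightarrow> bool" where
  "recfn F \<longleftrightarrow> (\<exists>p. \<forall>X x. eval X p x (F X x))"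

abbreviation decfn :: "((nat \<Rightarrow> nat) \<Rightarrow> nat \<Rightarrow> bool) \<Rightarrow> bool" where
  "decfn P \<equiv> recfn (\<lambda>X x. of_bool (P X x))"

lemma recfn_comp:
  assumes "recfn F" "recfn G"
  shows "recfn (\<lambda>X x. F X (G X x))"
  using assms unfolding recfn_def by (meson eval.Comp)

lemma recfn_id: "recfn (\<lambda>X x. x)"
  unfolding recfn_def
proof (intro exI allI)
  fix X :: "nat \<Rightarrow> nat" and x
  show "eval X (PPair PFst PSnd) x x"
    using eval.Pair[OF eval.Fst eval.Snd, of X x] by simp
qed

lemma recfn_Suc: "recfn A \<Longrightarrow> recfn (\<lambda>X x. Suc (A X x))"
  unfolding recfn_def by (meson eval.Comp eval.Succ)

lemma recfn_fst: "recfn A \<Longrightarrow> recfn (\<lambda>X x. \<pi>1 (A X x))"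
  unfolding recfn_def by (meson eval.Comp eval.Fst)

lemma recfn_snd: "recfn A \<Longrightarrow> recfn (\<lambda>X x. \<pi>2 (A X x))"
  unfolding recfn_def by (meson eval.Comp eval.Snd)

lemma recfn_oracle: "recfn A \<Longrightarrow> recfn (\<lambda>X x. X (A X x))"
  unfolding recfn_def by (meson eval.Comp eval.Oracle)

lemma recfn_pair: "recfn A \<Longrightarrow> recfn B \<Longrightarrow> recfn (\<lambda>X x. prod_encode (A X x, B X x))"
  unfolding recfn_def by (meson eval.Pair)

primrec const_prog :: "nat \<Rightarrow> prog" where
  "const_prog 0 = PZero"
| "const_prog (Suc n) = PComp PSucc (const_prog n)"

lemma eval_const_prog: "eval X (const_prog n) x n"
  by (induction n) (auto intro: eval.intros)

lemma recfn_const: "recfn (\<lambda>X x. c)"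
  unfolding recfn_def using eval_const_prog by blast

lemma recfn_comp2:
  assumes "recfn (\<lambda>X z. F X (\<pi>1 z) (\<pi>2 z))" "recfn A" "recfn B"
  shows "recfn (\<lambda>X x. F X (A X x) (B X x))"
  using recfn_comp[OF assms(1) recfn_pair[OF assms(2,3)]] by simp

lemma recfn_comp3:
  assumes "recfn (\<lambda>X z. F X (\<pi>1 z) (\<pi>1 (\<pi>2 z)) (\<pi>2 (\<pi>2 z)))" "recfn A" "recfn B" "recfn C"
  shows "recfn (\<lambda>X x. F X (A X x) (B X x) (C X x))"
  using recfn_comp[OF assms(1) recfn_pair[OF assms(2) recfn_pair[OF assms(3,4)]]] by simp

lemma recfn_rec_nat:
  assumes "recfn A" "recfn N"
    and B: "recfn (\<lambda>X z. B X (\<pi>1 z) (\<pi>1 (\<pi>2 z)) (\<pi>2 (\<pi>2 z)))"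
  shows "recfn (\<lambda>X x. rec_nat (A X x) (B X x) (N X x))"
proof -
  obtain p where p: "\<And>X x. eval X p x (A X x)"
    using assms(1) unfolding recfn_def by blast
  obtain q where q: "\<And>X z. eval X q z (B X (\<pi>1 z) (\<pi>1 (\<pi>2 z)) (\<pi>2 (\<pi>2 z)))"
    using B unfolding recfn_def by blast
  have "eval X (PRec p q) (prod_encode (x, n)) (rec_nat (A X x) (B X x) n)" for X x n
  proof (induction n)
    case (Suc n)
    show ?case
      using eval.Rec_Suc[OF Suc q] by simp
  qed (simp add: eval.Rec_0 p)
  from this[of _ "\<pi>1 z" "\<pi>2 z" for z]
  have "eval X (PRec p q) z (rec_nat (A X (\<pi>1 z)) (B X (\<pi>1 z)) (\<pi>2 z))" for X z
    by simp
  then have "recfn (\<lambda>X z. rec_nat (A X (\<pi>1 z)) (B X (\<pi>1 z)) (\<pi>2 z))"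
    unfolding recfn_def by blast
  from recfn_comp2[where F = "\<lambda>X x. rec_nat (A X x) (B X x)", OF this recfn_id assms(2)]
  show ?thesis .
qed

lemmas recfn_basic = recfn_id recfn_const recfn_Suc recfn_fst recfn_snd recfn_oracle recfn_pair

lemma recfn_if0:
  assumes "recfn C" "recfn A" "recfn B"
  shows "recfn (\<lambda>X x. if C X x = 0 then A X x else B X x)"
proof -
  have "recfn (\<lambda>X x. rec_nat (A X x) (\<lambda>_ _. B X x) (C X x))"
    by (intro recfn_rec_nat assms recfn_comp[OF assms(3)] recfn_basic)
  moreover have "rec_nat a (\<lambda>_ _. b) c = (if c = 0 then a else b)" for a b c :: nat
    by (cases c) auto
  ultimately show ?thesis by simp
qed

lemma recfn_add:
  assumes "recfn A" "recfn B"
  shows "recfn (\<lambda>X x. A X x + B X x)"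
proof (rule recfn_comp2[where F = "\<lambda>_. (+)", OF _ assms])
  have "rec_nat a (\<lambda>_ y. Suc y) b = a + b" for a b
    by (induction b) auto
  moreover have "recfn (\<lambda>X z. rec_nat (\<pi>1 z) (\<lambda>_ y. Suc y) (\<pi>2 z))"
    by (intro recfn_rec_nat recfn_basic)
  ultimately show "recfn (\<lambda>X z. \<pi>1 z + \<pi>2 z)" by simp
qed

lemma recfn_mult:
  assumes "recfn A" "recfn B"
  shows "recfn (\<lambda>X x. A X x * B X x)"
proof (rule recfn_comp2[where F = "\<lambda>_ a b. a * b", OF _ assms])
  have "rec_nat 0 (\<lambda>_ y. y + a) b = a * b" for a b :: nat
    by (induction b) auto
  moreover have "recfn (\<lambda>X z. rec_nat 0 (\<lambda>_ y. y + \<pi>1 z) (\<pi>2 z))"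
    by (intro recfn_rec_nat recfn_basic recfn_add)
  ultimately show "recfn (\<lambda>X z. \<pi>1 z * \<pi>2 z)" by simp
qed

lemma recfn_power:
  assumes "recfn A" "recfn B"
  shows "recfn (\<lambda>X x. A X x ^ B X x)"
proof (rule recfn_comp2[where F = "\<lambda>_. (^)", OF _ assms])
  have "rec_nat 1 (\<lambda>_ y. y * a) b = a ^ b" for a b :: nat
    by (induction b) auto
  moreover have "recfn (\<lambda>X z. rec_nat 1 (\<lambda>_ y. y * \<pi>1 z) (\<pi>2 z))"
    by (intro recfn_rec_nat recfn_basic recfn_mult)
  ultimately show "recfn (\<lambda>X z. \<pi>1 z ^ \<pi>2 z)" by simp
qed

lemma recfn_diff:
  assumes "recfn A" "recfn B"
  shows "recfn (\<lambda>X x. A X x - B X x)"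
proof (rule recfn_comp2[where F = "\<lambda>_. (-)", OF _ assms])
  have "rec_nat 0 (\<lambda>n _. n) b = b - 1" for b :: nat
    by (induction b) auto
  moreover have "recfn (\<lambda>X z. rec_nat 0 (\<lambda>n _. n) z)"
    by (intro recfn_rec_nat recfn_basic)
  ultimately have pred: "recfn (\<lambda>X z. z - 1)" by simp
  have "rec_nat a (\<lambda>_ y. y - 1) b = a - b" for a b :: nat
    by (induction b) auto
  moreover have "recfn (\<lambda>X z. rec_nat (\<pi>1 z) (\<lambda>_ y. y - 1) (\<pi>2 z))"
    by (intro recfn_rec_nat recfn_basic recfn_comp[OF pred])
  ultimately show "recfn (\<lambda>X z. \<pi>1 z - \<pi>2 z)" by simp
qed

lemma decfn_le: "recfn A \<Longrightarrow> recfn B \<Longrightarrow> decfn (\<lambda>X x. A X x \<le> B X x)"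
proof -
  assume "recfn A" "recfn B"
  then have "recfn (\<lambda>X x. if A X x - B X x = 0 then 1 else 0)"
    by (intro recfn_if0 recfn_diff recfn_const)
  moreover have "(if a - b = 0 then 1 else 0) = (of_bool (a \<le> b) :: nat)" for a b :: nat
    by simp
  ultimately show ?thesis by simp
qed

lemma decfn_not:
  assumes "decfn P"
  shows "decfn (\<lambda>X x. \<not> P X x)"
proof -
  have "1 - of_bool p = (of_bool (\<not> p) :: nat)" for p
    by (cases p) auto
  then show ?thesis
    using recfn_diff[OF recfn_const[of 1] assms] by simp
qed

lemma decfn_conj:
  assumes "decfn P" "decfn Q"
  shows "decfn (\<lambda>X x. P X x \<and> Q X x)"
  using recfn_mult[OF assms] by (simp only: of_bool_conj)

lemma decfn_disj:
  assumes "decfn P" "decfn Q"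
  shows "decfn (\<lambda>X x. P X x \<or> Q X x)"
  using decfn_not[OF decfn_conj[OF assms[THEN decfn_not]]]
  by (simp only: de_Morgan_conj not_not)

lemma decfn_imp:
  assumes "decfn P" "decfn Q"
  shows "decfn (\<lambda>X x. P X x \<longrightarrow> Q X x)"
  using decfn_disj[OF decfn_not[OF assms(1)] assms(2)] by (simp only: imp_conv_disj)

lemma decfn_eq:
  assumes "recfn A" "recfn B"
  shows "decfn (\<lambda>X x. A X x = B X x)"
  using decfn_conj[OF decfn_le[OF assms] decfn_le[OF assms(2,1)]]
  by (simp only: order_eq_iff)

lemma decfn_less:
  assumes "recfn A" "recfn B"
  shows "decfn (\<lambda>X x. A X x < B X x)"
  using decfn_not[OF decfn_le[OF assms(2,1)]] by (simp only: not_le)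

lemma decfn_iff:
  assumes "decfn P" "decfn Q"
  shows "decfn (\<lambda>X x. P X x \<longleftrightarrow> Q X x)"
  using decfn_eq[OF assms] by (simp only: of_bool_eq_iff)

lemma recfn_if:
  assumes "decfn P" "recfn A" "recfn B"
  shows "recfn (\<lambda>X x. if P X x then A X x else B X x)"
proof -
  have "(if of_bool p = (0::nat) then b else a) = (if p then a else b)" for p and a b :: nat
    by simp
  with recfn_if0[OF assms(1,3,2)] show ?thesis by simp
qed

lemma decfn_ex:
  assumes "recfn N" "decfn (\<lambda>X z. P X (\<pi>1 z) (\<pi>2 z))"
  shows "decfn (\<lambda>X x. \<exists>n<N X x. P X x n)"
proof -
  have "rec_nat 0 (\<lambda>n y. if P X x n then Suc 0 else y) N = of_bool (\<exists>n<N. P X x n)" for X x N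
    by (induction N) (auto simp: less_Suc_eq)
  moreover have "recfn (\<lambda>X x. rec_nat 0 (\<lambda>n y. if P X x n then Suc 0 else y) (N X x))"
    by (intro recfn_rec_nat recfn_basic recfn_if assms(1) recfn_comp2[where F = "\<lambda>X x n. of_bool (P X x n)", OF assms(2)])
  ultimately show ?thesis by simp
qed

lemma decfn_all:
  assumes "recfn N" "decfn (\<lambda>X z. P X (\<pi>1 z) (\<pi>2 z))"
  shows "decfn (\<lambda>X x. \<forall>n<N X x. P X x n)"
  using decfn_not[OF decfn_ex[OF assms(1), of "\<lambda>X x n. \<not> P X x n", OF decfn_not[OF assms(2)]]]
  by simp

lemma recfn_card:
  assumes "recfn N" "decfn (\<lambda>X z. P X (\<pi>1 z) (\<pi>2 z))"
  shows "recfn (\<lambda>X x. card {n. n < N X x \<and> P X x n})"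
proof -
  have "rec_nat 0 (\<lambda>n y. of_bool (P X x n) + y) N = card {n. n < N \<and> P X x n}" for X x N
  proof (induction N)
    case (Suc N)
    have "{n. n < Suc N \<and> P X x n} = {n. n < N \<and> P X x n} \<union> (if P X x N then {N} else {})"
      by (auto simp: less_Suc_eq)
    then show ?case by (simp add: Suc)
  qed simp
  moreover have "recfn (\<lambda>X x. rec_nat 0 (\<lambda>n y. of_bool (P X x n) + y) (N X x))"
    by (intro recfn_rec_nat recfn_basic recfn_add assms(1) recfn_comp2[where F = "\<lambda>X x n. of_bool (P X x n)", OF assms(2)])
  ultimately show ?thesis by simp
qed

text \<open>Bit \<open>z\<close> of \<open>c\<close> is the parity of \<open>c div 2 ^ z\<close>.
  Parity arises by toggling, and \<open>n div 2\<close> counts the odd numbers below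
  \<open>n\<close>.\<close>

lemma decfn_mem:
  assumes "recfn Z" "recfn C"
  shows "decfn (\<lambda>X x. Z X x \<in> set_decode (C X x))"
proof -
  have "rec_nat 0 (\<lambda>_ y. 1 - y) n = n mod 2" for n :: nat
    by (induction n) (auto simp: mod_Suc)
  moreover have "recfn (\<lambda>X z. rec_nat 0 (\<lambda>_ y. 1 - y) z)"
    by (intro recfn_rec_nat recfn_basic recfn_diff)
  ultimately have mod2: "recfn (\<lambda>X z. z mod 2)" by simp
  have "rec_nat 0 (\<lambda>n y. y + n mod 2) n = n div 2" for n :: nat
    by (induction n) (auto, presburger)
  moreover have "recfn (\<lambda>X z. rec_nat 0 (\<lambda>n y. y + n mod 2) z)"
    by (intro recfn_rec_nat recfn_basic recfn_add recfn_comp[OF mod2])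
  ultimately have div2: "recfn (\<lambda>X z. z div 2)" by simp
  have "rec_nat c (\<lambda>_ y. y div 2) n = c div 2 ^ n" for c n :: nat
    by (induction n) (auto simp: div_mult2_eq power_Suc2 simp del: power_Suc)
  moreover have "recfn (\<lambda>X x. rec_nat (C X x) (\<lambda>_ y. y div 2) (Z X x))"
    by (intro recfn_rec_nat recfn_basic recfn_comp[OF div2] assms)
  ultimately have "recfn (\<lambda>X x. (C X x div 2 ^ Z X x) mod 2)"
    using recfn_comp[OF mod2] by simp
  moreover have "(c div 2 ^ n) mod 2 = of_bool (n \<in> set_decode c)" for c n
    by (auto simp: set_decode_def odd_iff_mod_2_eq_one)
  ultimately show ?thesis by simp
qed

lemmas recfn_intros = recfn_basic recfn_add recfn_mult recfn_power recfn_diff recfn_if recfn_card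
  recfn_rec_nat decfn_le decfn_not decfn_conj decfn_disj decfn_imp decfn_eq decfn_less decfn_iff
  decfn_ex decfn_all decfn_mem

section \<open>Unbounded search and the s-m-n theorem\<close>

text \<open>The source of the partial programs below. The equivalence also excludes spurious values,
  so domains come out as exact c.e. sets.\<close>

lemma search_prog:
  assumes "decfn (\<lambda>X z. P X (\<pi>1 z) (\<pi>2 z))"
  shows "\<exists>p. \<forall>X x y. eval X p x y \<longleftrightarrow> P X x y \<and> (\<forall>m<y. \<not> P X x m)"
proof -
  from decfn_not[OF assms] obtain p where
    p: "\<And>X z. eval X p z (of_bool (\<not> P X (\<pi>1 z) (\<pi>2 z)))"
    unfolding recfn_def by blast
  then have p': "eval X p (prod_encode (x, n)) (of_bool (\<not> P X x n))" for X x n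
    by (metis fst_conv snd_conv prod_encode_inverse)
  have iff: "eval X p (prod_encode (x, n)) v \<longleftrightarrow> v = of_bool (\<not> P X x n)" for X x n v
    using p' eval_deterministic by blast
  have "eval X (PMin p) x y \<longleftrightarrow> P X x y \<and> (\<forall>m<y. \<not> P X x m)" for X x y
  proof
    assume "eval X (PMin p) x y"
    then show "P X x y \<and> (\<forall>m<y. \<not> P X x m)"
      by cases (auto simp: iff)
  next
    assume "P X x y \<and> (\<forall>m<y. \<not> P X x m)"
    then show "eval X (PMin p) x y"
      by (intro eval.Min) (auto simp: iff)
  qed
  then show ?thesis by blast
qed

lemma search_prog_halts:
  assumes "\<And>X x y. eval X p x y \<longleftrightarrow> P X x y \<and> (\<forall>m<y. \<not> P X x m)"
  shows "(\<exists>y. eval X p x y) \<longleftrightarrow> (\<exists>y. P X x y)"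
  using assms exists_least_iff[of "P X x"] by auto

lemma recfn_Least:
  assumes "decfn (\<lambda>X z. P X (\<pi>1 z) (\<pi>2 z))" "\<And>X x. \<exists>n. P X x n"
  shows "recfn (\<lambda>X x. LEAST n. P X x n)"
proof -
  obtain p where p: "\<And>X x y. eval X p x y \<longleftrightarrow> P X x y \<and> (\<forall>m<y. \<not> P X x m)"
    using search_prog[OF assms(1)] by blast
  then show ?thesis
    unfolding recfn_def using LeastI_ex[OF assms(2)] not_less_Least by metis
qed

lemma Phi_prog_index: "Phi (prog_index p) f x y \<longleftrightarrow> eval f p x y"
  unfolding Phi_def using injD[OF inj_prog_index] by blast

lemma recfn_imp_computable: "recfn (\<lambda>X. g) \<Longrightarrow> computable g"
  unfolding recfn_def computable_def computable_in_def Phi_total_def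
  using Phi_prog_index by blast

lemma recfn_const_prog_index:
  assumes "recfn A"
  shows "recfn (\<lambda>X x. prog_index (const_prog (A X x)))"
proof -
  \<comment> \<open>\<open>0\<close> is the index of \<open>PZero\<close>, \<open>Suc 0\<close> that
    of \<open>PSucc\<close>, and \<open>+ 6\<close> tags a composition.\<close>
  have "rec_nat 0 (\<lambda>_ y. 4 * prod_encode (Suc 0, y) + 6) n = prog_index (const_prog n)" for n
    by (induction n) auto
  moreover have "recfn (\<lambda>X x. rec_nat 0 (\<lambda>_ y. 4 * prod_encode (Suc 0, y) + 6) (A X x))"
    by (intro recfn_intros assms)
  ultimately show ?thesis by (simp only:)
qed

text \<open>The parameter is hard-wired by a constant program. \<open>PPair PFst PSnd\<close> is the
  identity, which is not among the basic functions.\<close>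

definition smn :: "prog \<Rightarrow> nat \<Rightarrow> prog" where
  "smn p a = PComp p (PPair (const_prog a) (PPair PFst PSnd))"

lemma eval_smn: "eval X (smn p a) x y \<longleftrightarrow> eval X p (prod_encode (a, x)) y"
proof -
  have arg: "eval X (PPair (const_prog a) (PPair PFst PSnd)) x (prod_encode (a, x))"
    using eval.Pair[OF eval_const_prog eval.Pair[OF eval.Fst eval.Snd], of X a x] by simp
  show ?thesis
  proof
    assume "eval X (smn p a) x y"
    then show "eval X p (prod_encode (a, x)) y"
      unfolding smn_def by cases (metis arg eval_deterministic)
  qed (auto simp: smn_def intro: eval.Comp[OF arg])
qed

lemma recfn_smn:
  assumes "recfn A"
  shows "recfn (\<lambda>X x. prog_index (smn p (A X x)))"
  unfolding smn_def prog_index.simps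
  by (intro recfn_intros recfn_const_prog_index assms)

section \<open>Finite certificates for computations\<close>

definition triple :: "nat \<Rightarrow> nat \<Rightarrow> nat \<Rightarrow> nat" where
  "triple e x y = prod_encode (e, prod_encode (x, y))"

text \<open>One disjunct per evaluation rule, on indices as assigned by \<open>prog_index\<close>.
  The oracle is a relation, so that a finite string, which answers only some queries, can take its
  place.\<close>

definition justified :: "(nat \<Rightarrow> nat \<Rightarrow> bool) \<Rightarrow> nat set \<Rightarrow> nat \<Rightarrow> nat \<Rightarrow> nat \<Rightarrow> bool" where
  "justified Q S e x y \<longleftrightarrow>
     e = 0 \<and> y = 0 \<or> e = 1 \<and> y = Suc x \<or> e = 2 \<and> y = \<pi>1 x \<or> e = 3 \<and> y = \<pi>2 x \<or> e = 4 \<and> Q x y \<or>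
     (\<exists>p q. e = 4 * prod_encode (p, q) + 5 \<and> triple p x (\<pi>1 y) \<in> S \<and> triple q x (\<pi>2 y) \<in> S) \<or>
     (\<exists>p q. e = 4 * prod_encode (p, q) + 6 \<and> (\<exists>u. triple q x u \<in> S \<and> triple p u y \<in> S)) \<or>
     (\<exists>p q. e = 4 * prod_encode (p, q) + 7 \<and>
        (if \<pi>2 x = 0 then triple p (\<pi>1 x) y \<in> S
         else \<exists>u. triple e (prod_encode (\<pi>1 x, \<pi>2 x - 1)) u \<in> S \<and>
           triple q (prod_encode (\<pi>1 x, prod_encode (\<pi>2 x - 1, u))) y \<in> S)) \<or>
     (\<exists>p. e = 4 * p + 8 \<and> triple p (prod_encode (x, y)) 0 \<in> S \<and>
        (\<forall>m<y. \<exists>v. 0 < v \<and> triple p (prod_encode (x, m)) v \<in> S))"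

text \<open>
  A certificate cannot be circular: the triples that justify \<open>(e, x, y)\<close> belong to proper
  subprograms of \<open>e\<close> or, for primitive recursion, to the same program with a smaller recursion
  argument.  So no order on the derivation has to be recorded, and certificates are closed under union.
\<close>

definition certificate :: "(nat \<Rightarrow> nat \<Rightarrow> bool) \<Rightarrow> nat set \<Rightarrow> bool" where
  "certificate Q S \<longleftrightarrow> (\<forall>e x y. triple e x y \<in> S \<longrightarrow> justified Q S e x y)"

text \<open>All occurrences of \<open>S\<close> are positive; rewriting the conditional as a
  disjunction exposes this to the monotonicity rules.\<close>

lemma justified_mono:
  assumes "justified Q S e x y" and "S \<subseteq> T"
  shows "justified Q T e x y"
proof -
  have mem: "z \<in> S \<longrightarrow> z \<in> T" for z
    using assms(2) by blast
  have "justified Q S e x y \<longrightarrow> justified Q T e x y"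
    unfolding justified_def if_bool_eq_disj
    by (intro disj_mono conj_mono ex_mono all_mono imp_mono mem imp_refl)
  with assms(1) show ?thesis by blast
qed

lemma certificate_UN: "(\<And>i. i \<in> I \<Longrightarrow> certificate Q (S i)) \<Longrightarrow> certificate Q (\<Union>i\<in>I. S i)"
  unfolding certificate_def by (meson UN_E UN_upper justified_mono)

lemma certificate_Un: "certificate Q S \<Longrightarrow> certificate Q T \<Longrightarrow> certificate Q (S \<union> T)"
  unfolding certificate_def by (metis UnE justified_mono sup_ge1 sup_ge2)

lemma certificate_insert:
  assumes "certificate Q S" "justified Q S e x y"
  shows "certificate Q (insert (triple e x y) S)"
proof -
  have "justified Q (insert (triple e x y) S) e' x' y'"
    if "triple e' x' y' \<in> insert (triple e x y) S" for e' x' y'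
  proof (rule justified_mono)
    show "justified Q S e' x' y'"
      using that assms by (auto simp: certificate_def triple_def)
  qed auto
  then show ?thesis by (simp add: certificate_def)
qed

text \<open>The tags 5 to 8 separate compound programs modulo 4 and exceed the five basic indices.
  The facts serve the inversion rules \<open>justified_prog_index\<close>.\<close>

lemma mod4_neq:
  fixes a b :: nat
  shows "4 * a + 5 \<noteq> 4 * b + 6" "4 * a + 5 \<noteq> 4 * b + 7" "4 * a + 5 \<noteq> 4 * b + 8"
    "4 * a + 6 \<noteq> 4 * b + 5" "4 * a + 6 \<noteq> 4 * b + 7" "4 * a + 6 \<noteq> 4 * b + 8"
    "4 * a + 7 \<noteq> 4 * b + 5" "4 * a + 7 \<noteq> 4 * b + 6" "4 * a + 7 \<noteq> 4 * b + 8"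
    "4 * a + 8 \<noteq> 4 * b + 5" "4 * a + 8 \<noteq> 4 * b + 6" "4 * a + 8 \<noteq> 4 * b + 7"
    "4 * a + 5 \<noteq> 0" "4 * a + 6 \<noteq> 0" "4 * a + 7 \<noteq> 0" "4 * a + 8 \<noteq> 0"
    "4 * a + 5 \<noteq> 1" "4 * a + 6 \<noteq> 1" "4 * a + 7 \<noteq> 1" "4 * a + 8 \<noteq> 1"
    "4 * a + 5 \<noteq> 2" "4 * a + 6 \<noteq> 2" "4 * a + 7 \<noteq> 2" "4 * a + 8 \<noteq> 2"
    "4 * a + 5 \<noteq> 3" "4 * a + 6 \<noteq> 3" "4 * a + 7 \<noteq> 3" "4 * a + 8 \<noteq> 3"
    "4 * a + 5 \<noteq> 4" "4 * a + 6 \<noteq> 4" "4 * a + 7 \<noteq> 4" "4 * a + 8 \<noteq> 4"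
    "0 \<noteq> 4 * a + 5" "0 \<noteq> 4 * a + 6" "0 \<noteq> 4 * a + 7" "0 \<noteq> 4 * a + 8"
    "1 \<noteq> 4 * a + 5" "1 \<noteq> 4 * a + 6" "1 \<noteq> 4 * a + 7" "1 \<noteq> 4 * a + 8"
    "2 \<noteq> 4 * a + 5" "2 \<noteq> 4 * a + 6" "2 \<noteq> 4 * a + 7" "2 \<noteq> 4 * a + 8"
    "3 \<noteq> 4 * a + 5" "3 \<noteq> 4 * a + 6" "3 \<noteq> 4 * a + 7" "3 \<noteq> 4 * a + 8"
    "4 \<noteq> 4 * a + 5" "4 \<noteq> 4 * a + 6" "4 \<noteq> 4 * a + 7" "4 \<noteq> 4 * a + 8"
  by presburger+

lemma small_neq:
  "(0::nat) \<noteq> 1" "(0::nat) \<noteq> 2" "(0::nat) \<noteq> 3" "(0::nat) \<noteq> 4"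
  "(1::nat) \<noteq> 0" "(1::nat) \<noteq> 2" "(1::nat) \<noteq> 3" "(1::nat) \<noteq> 4"
  "(2::nat) \<noteq> 0" "(2::nat) \<noteq> 1" "(2::nat) \<noteq> 3" "(2::nat) \<noteq> 4"
  "(3::nat) \<noteq> 0" "(3::nat) \<noteq> 1" "(3::nat) \<noteq> 2" "(3::nat) \<noteq> 4"
  "(4::nat) \<noteq> 0" "(4::nat) \<noteq> 1" "(4::nat) \<noteq> 2" "(4::nat) \<noteq> 3"
  by simp_all

lemma ex_eq_pair: "(\<exists>p q. (a = p \<and> b = q) \<and> P p q) \<longleftrightarrow> P a b"
  by auto

lemma justified_prog_index:
  "justified Q S (prog_index PZero) x y \<longleftrightarrow> y = 0"
  "justified Q S (prog_index PSucc) x y \<longleftrightarrow> y = Suc x"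
  "justified Q S (prog_index PFst) x y \<longleftrightarrow> y = \<pi>1 x"
  "justified Q S (prog_index PSnd) x y \<longleftrightarrow> y = \<pi>2 x"
  "justified Q S (prog_index POracle) x y \<longleftrightarrow> Q x y"
  "justified Q S (prog_index (PPair p q)) x y \<longleftrightarrow>
     triple (prog_index p) x (\<pi>1 y) \<in> S \<and> triple (prog_index q) x (\<pi>2 y) \<in> S"
  "justified Q S (prog_index (PComp p q)) x y \<longleftrightarrow>
     (\<exists>u. triple (prog_index q) x u \<in> S \<and> triple (prog_index p) u y \<in> S)"
  "justified Q S (prog_index (PRec p q)) x y \<longleftrightarrow>
     (if \<pi>2 x = 0 then triple (prog_index p) (\<pi>1 x) y \<in> S
      else \<exists>u. triple (prog_index (PRec p q)) (prod_encode (\<pi>1 x, \<pi>2 x - 1)) u \<in> S \<and>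
        triple (prog_index q) (prod_encode (\<pi>1 x, prod_encode (\<pi>2 x - 1, u))) y \<in> S)"
  "justified Q S (prog_index (PMin p)) x y \<longleftrightarrow> triple (prog_index p) (prod_encode (x, y)) 0 \<in> S \<and>
     (\<forall>m<y. \<exists>v. 0 < v \<and> triple (prog_index p) (prod_encode (x, m)) v \<in> S)"
  by (simp_all only: justified_def prog_index.simps mod4_neq add_right_cancel mult_cancel1
      prod_encode_eq prod.inject simp_thms ex_simps small_neq ex_eq_pair)

text \<open>Structural induction works because a justification refers to subprograms. Only
  \<open>PRec\<close> also refers to itself, which an inner induction on the recursion argument
  resolves.\<close>

lemma certificate_sound:
  assumes cert: "certificate Q S" and Q: "\<And>x y. Q x y \<Longrightarrow> f x = y"
  shows "triple (prog_index p) x y \<in> S \<Longrightarrow> eval f p x y"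
proof (induction p arbitrary: x y)
  have just: "justified Q S (prog_index p) x y" if "triple (prog_index p) x y \<in> S" for p x y
    using cert that unfolding certificate_def by blast
  {
    case PZero
    from just[OF PZero] show ?case by (simp only: justified_prog_index eval.Zero)
  next
    case PSucc
    from just[OF PSucc] show ?case by (simp only: justified_prog_index eval.Succ)
  next
    case PFst
    from just[OF PFst] show ?case by (simp only: justified_prog_index eval.Fst)
  next
    case PSnd
    from just[OF PSnd] show ?case by (simp only: justified_prog_index eval.Snd)
  next
    case POracle
    from just[OF POracle] have "f x = y" by (simp only: justified_prog_index Q)
    then show ?case using eval.Oracle[of f x] by simp
  next
    case (PPair p q)
    from just[OF PPair.prems] have "eval f p x (\<pi>1 y)" "eval f q x (\<pi>2 y)"
      unfolding justified_prog_index by (auto intro: PPair.IH)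
    from eval.Pair[OF this] show ?case by simp
  next
    case (PComp p q)
    from just[OF PComp.prems] show ?case
      unfolding justified_prog_index by (auto intro: PComp.IH eval.Comp)
  next
    case (PRec p q)
    have "triple (prog_index (PRec p q)) (prod_encode (a, n)) y \<in> S \<Longrightarrow>
      eval f (PRec p q) (prod_encode (a, n)) y" for a n y
    proof (induction n arbitrary: y)
      case 0
      from just[OF 0] show ?case
        unfolding justified_prog_index by (auto intro: PRec.IH eval.Rec_0)
    next
      case (Suc n)
      from just[OF Suc.prems] show ?case
        unfolding justified_prog_index by (auto intro!: PRec.IH Suc.IH intro: eval.Rec_Suc)
    qed
    from this[of "\<pi>1 x" "\<pi>2 x"] PRec.prems show ?case by (simp del: prog_index.simps)
  next
    case (PMin p)
    from just[OF PMin.prems] show ?case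
      unfolding justified_prog_index by (blast intro: PMin.IH eval.Min)
  }
qed

text \<open>Along the derivation, the certificates of the premises are united and the conclusion is
  added. A minimization that stops at \<open>n\<close> has finitely many premises, so the set stays
  finite and can be coded by a number.\<close>

lemma certificate_complete:
  assumes "eval f p x y"
  shows "\<exists>S. finite S \<and> certificate (\<lambda>x y. y = f x) S \<and> triple (prog_index p) x y \<in> S"
proof -
  let ?cert = "\<lambda>S. finite S \<and> certificate (\<lambda>x y. y = f x) S"
  have ins: "\<exists>S. ?cert S \<and> triple (prog_index p) x y \<in> S"
    if "?cert S" "justified (\<lambda>x y. y = f x) S (prog_index p) x y" for p x y S
    using that certificate_insert by (intro exI[of _ "insert (triple (prog_index p) x y) S"]) auto
  have empty: "?cert {}"
    by (simp add: certificate_def)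
  have un: "?cert (S \<union> T)" if "?cert S" "?cert T" for S T
    using that certificate_Un by auto
  have "\<exists>S. ?cert S \<and> triple (prog_index p) x y \<in> S"
    using assms
  proof induction
    case (Zero x)
    show ?case by (rule ins[OF empty]) (simp only: justified_prog_index)
  next
    case (Succ x)
    show ?case by (rule ins[OF empty]) (simp only: justified_prog_index)
  next
    case (Fst x)
    show ?case by (rule ins[OF empty]) (simp only: justified_prog_index)
  next
    case (Snd x)
    show ?case by (rule ins[OF empty]) (simp only: justified_prog_index)
  next
    case (Oracle x)
    show ?case by (rule ins[OF empty]) (simp only: justified_prog_index)
  next
    case (Pair p x y q z)
    then obtain S T where "?cert S" "triple (prog_index p) x y \<in> S"
      "?cert T" "triple (prog_index q) x z \<in> T" by blast
    then show ?case
      by (intro ins[of "S \<union> T"] un) (simp_all add: justified_prog_index del: prog_index.simps)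
  next
    case (Comp q x y p z)
    then obtain S T where "?cert S" "triple (prog_index q) x y \<in> S"
      "?cert T" "triple (prog_index p) y z \<in> T" by blast
    then show ?case
      by (intro ins[of "S \<union> T"] un) (auto simp add: justified_prog_index simp del: prog_index.simps)
  next
    case (Rec_0 p a y q)
    then obtain S where "?cert S" "triple (prog_index p) a y \<in> S" by blast
    then show ?case
      by (intro ins[of S]) (simp_all add: justified_prog_index del: prog_index.simps)
  next
    case (Rec_Suc p q a n y z)
    then obtain S T where "?cert S" "triple (prog_index (PRec p q)) (prod_encode (a, n)) y \<in> S"
      "?cert T" "triple (prog_index q) (prod_encode (a, prod_encode (n, y))) z \<in> T" by blast
    then show ?case
      by (intro ins[of "S \<union> T"] un) (auto simp add: justified_prog_index simp del: prog_index.simps)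
  next
    case (Min p a n)
    from Min.IH(1) obtain S where
      S: "?cert S" "triple (prog_index p) (prod_encode (a, n)) 0 \<in> S" by blast
    from Min.IH(2) have "\<forall>m. \<exists>T. m < n \<longrightarrow>
      ?cert T \<and> (\<exists>v>0. triple (prog_index p) (prod_encode (a, m)) v \<in> T)" by blast
    then obtain T where T: "\<And>m. m < n \<Longrightarrow>
      ?cert (T m) \<and> (\<exists>v>0. triple (prog_index p) (prod_encode (a, m)) v \<in> T m)"
      by metis
    have U: "?cert (\<Union>m\<in>{..<n}. T m)"
      using T certificate_UN[of "{..<n}"] by auto
    show ?case
    proof (rule ins[OF un[OF S(1) U]], unfold justified_prog_index, intro conjI allI impI)
      show "triple (prog_index p) (prod_encode (a, n)) 0 \<in> S \<union> (\<Union>m\<in>{..<n}. T m)"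
        using S(2) by blast
      fix m assume "m < n"
      with T[of m] show "\<exists>v>0. triple (prog_index p) (prod_encode (a, m)) v \<in> S \<union> (\<Union>m\<in>{..<n}. T m)"
        by blast
    qed
  qed
  then show ?thesis by blast
qed

lemma mem_set_decode_less: "z \<in> set_decode c \<Longrightarrow> z < c"
proof -
  assume "z \<in> set_decode c"
  then have "set_decode (2 ^ z) \<subseteq> set_decode c"
    using set_decode_plus_power_2[of z 0] by simp
  then have "2 ^ z \<le> c" by (rule subset_decode_imp_le)
  then show ?thesis using less_exp[of z] by linarith
qed

lemma less_prod_encode_bound:
  "prod_encode (a, b) < c \<Longrightarrow> a < c" "prod_encode (a, b) < c \<Longrightarrow> b < c"
  using le_prod_encode_1 le_prod_encode_2 le_less_trans by blast+

lemma triple_bound: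
  assumes "triple e x y \<in> set_decode c"
  shows "e < c" "x < c" "y < c"
  using mem_set_decode_less[OF assms] unfolding triple_def by (meson less_prod_encode_bound)+

text \<open>Everything a justification cites is below the code \<open>c\<close>, being a component
  of a coded triple or a subprogram index of \<open>e\<close>. Bounded quantifiers make the check
  decidable.\<close>

lemma justified_bounded:
  assumes mem: "triple e x y \<in> set_decode c"
  shows "justified Q (set_decode c) e x y \<longleftrightarrow>
     e = 0 \<and> y = 0 \<or> e = 1 \<and> y = Suc x \<or> e = 2 \<and> y = \<pi>1 x \<or> e = 3 \<and> y = \<pi>2 x \<or> e = 4 \<and> Q x y \<or>
     (\<exists>p<c. \<exists>q<c. e = 4 * prod_encode (p, q) + 5 \<and>
        triple p x (\<pi>1 y) \<in> set_decode c \<and> triple q x (\<pi>2 y) \<in> set_decode c) \<or>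
     (\<exists>p<c. \<exists>q<c. e = 4 * prod_encode (p, q) + 6 \<and>
        (\<exists>u<c. triple q x u \<in> set_decode c \<and> triple p u y \<in> set_decode c)) \<or>
     (\<exists>p<c. \<exists>q<c. e = 4 * prod_encode (p, q) + 7 \<and>
        (\<pi>2 x = 0 \<and> triple p (\<pi>1 x) y \<in> set_decode c \<or>
         \<pi>2 x \<noteq> 0 \<and> (\<exists>u<c. triple e (prod_encode (\<pi>1 x, \<pi>2 x - 1)) u \<in> set_decode c \<and>
           triple q (prod_encode (\<pi>1 x, prod_encode (\<pi>2 x - 1, u))) y \<in> set_decode c))) \<or>
     (\<exists>p<c. e = 4 * p + 8 \<and> triple p (prod_encode (x, y)) 0 \<in> set_decode c \<and>
        (\<forall>m<y. \<exists>v<c. 0 < v \<and> triple p (prod_encode (x, m)) v \<in> set_decode c))"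
proof -
  have e: "e < c" using triple_bound[OF mem] by simp
  have pair: "p < c" "q < c" if "e = 4 * prod_encode (p, q) + k" for p q k
  proof -
    have "prod_encode (p, q) < c" using e that by linarith
    then show "p < c" "q < c" by (meson less_prod_encode_bound)+
  qed
  have ex2: "(\<exists>p q. e = 4 * prod_encode (p, q) + k \<and> P p q) \<longleftrightarrow>
      (\<exists>p<c. \<exists>q<c. e = 4 * prod_encode (p, q) + k \<and> P p q)" for k P
    using pair by blast
  have ex1: "(\<exists>u. triple a b u \<in> set_decode c \<and> P u) \<longleftrightarrow>
      (\<exists>u<c. triple a b u \<in> set_decode c \<and> P u)" for a b P
    using triple_bound(3) by blast
  have ex3: "(\<exists>v. 0 < v \<and> triple a b v \<in> set_decode c) \<longleftrightarrow>
      (\<exists>v<c. 0 < v \<and> triple a b v \<in> set_decode c)" for a b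
    using triple_bound(3) by blast
  have ex4: "(\<exists>p. e = 4 * p + 8 \<and> P p) \<longleftrightarrow> (\<exists>p<c. e = 4 * p + 8 \<and> P p)" for P
  proof -
    have "p < c" if "e = 4 * p + 8" for p using e that by linarith
    then show ?thesis by blast
  qed
  show ?thesis
    unfolding justified_def if_bool_eq_disj
    by (simp only: ex2 ex1 ex3 ex4)
qed

lemma all_triple: "(\<forall>e x y. P (triple e x y)) \<longleftrightarrow> (\<forall>z. P z)"
proof
  assume P: "\<forall>e x y. P (triple e x y)"
  show "\<forall>z. P z"
  proof
    fix z
    from P[rule_format, of "\<pi>1 z" "\<pi>1 (\<pi>2 z)" "\<pi>2 (\<pi>2 z)"] show "P z"
      by (simp add: triple_def)
  qed
qed blast

lemma decfn_certificate:
  assumes C: "recfn C" and Q: "decfn (\<lambda>X z. Q X (\<pi>1 z) (\<pi>1 (\<pi>2 z)) (\<pi>2 (\<pi>2 z)))"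
  shows "decfn (\<lambda>X x. certificate (Q X x) (set_decode (C X x)))"
proof -
  let ?J = "\<lambda>Q c z.
    (let e = \<pi>1 z; x = \<pi>1 (\<pi>2 z); y = \<pi>2 (\<pi>2 z) in
     e = 0 \<and> y = 0 \<or> e = 1 \<and> y = Suc x \<or> e = 2 \<and> y = \<pi>1 x \<or> e = 3 \<and> y = \<pi>2 x \<or> e = 4 \<and> Q x y \<or>
     (\<exists>p<c. \<exists>q<c. e = 4 * prod_encode (p, q) + 5 \<and>
        triple p x (\<pi>1 y) \<in> set_decode c \<and> triple q x (\<pi>2 y) \<in> set_decode c) \<or>
     (\<exists>p<c. \<exists>q<c. e = 4 * prod_encode (p, q) + 6 \<and>
        (\<exists>u<c. triple q x u \<in> set_decode c \<and> triple p u y \<in> set_decode c)) \<or>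
     (\<exists>p<c. \<exists>q<c. e = 4 * prod_encode (p, q) + 7 \<and>
        (\<pi>2 x = 0 \<and> triple p (\<pi>1 x) y \<in> set_decode c \<or>
         \<pi>2 x \<noteq> 0 \<and> (\<exists>u<c. triple e (prod_encode (\<pi>1 x, \<pi>2 x - 1)) u \<in> set_decode c \<and>
           triple q (prod_encode (\<pi>1 x, prod_encode (\<pi>2 x - 1, u))) y \<in> set_decode c))) \<or>
     (\<exists>p<c. e = 4 * p + 8 \<and> triple p (prod_encode (x, y)) 0 \<in> set_decode c \<and>
        (\<forall>m<y. \<exists>v<c. 0 < v \<and> triple p (prod_encode (x, m)) v \<in> set_decode c)))"
  have "certificate Q (set_decode c) \<longleftrightarrow> (\<forall>z<c. z \<in> set_decode c \<longrightarrow> ?J Q c z)" for Q c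
  proof -
    have "certificate Q (set_decode c) \<longleftrightarrow>
      (\<forall>e x y. triple e x y \<in> set_decode c \<longrightarrow> ?J Q c (triple e x y))"
      unfolding certificate_def using justified_bounded[of _ _ _ c Q]
      by (simp only: Let_def triple_def prod_encode_inverse fst_conv snd_conv cong: imp_cong)
    also have "\<dots> \<longleftrightarrow> (\<forall>z. z \<in> set_decode c \<longrightarrow> ?J Q c z)"
      by (rule all_triple)
    finally show ?thesis using mem_set_decode_less by blast
  qed
  moreover have "decfn (\<lambda>X x. \<forall>z<C X x. z \<in> set_decode (C X x) \<longrightarrow> ?J (Q X x) (C X x) z)"
    unfolding Let_def triple_def
    by (intro recfn_intros C recfn_comp[OF C]
        recfn_comp3[where F = "\<lambda>X x a b. of_bool (Q X x a b)", OF Q])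
  ultimately show ?thesis by (simp only:)
qed

section \<open>Initial segments and fair coin measure\<close>

lemma justified_weaken:
  assumes "justified Q S e x y" "Q x y \<Longrightarrow> Q' x y"
  shows "justified Q' S e x y"
  using assms unfolding justified_def by argo

text \<open>The use principle: the oracle is consulted only at arguments recorded in
  \<open>S\<close>, so another oracle need agree only there.\<close>

lemma certificate_weaken:
  assumes "certificate Q S" "\<And>e x y. triple e x y \<in> S \<Longrightarrow> Q x y \<Longrightarrow> Q' x y"
  shows "certificate Q' S"
  using assms justified_weaken unfolding certificate_def by metis

text \<open>Kleene's T predicate. The witness \<open>s\<close> pairs the code of a certificate with
  the output value.\<close>

definition certifies :: "(nat \<Rightarrow> nat \<Rightarrow> bool) \<Rightarrow> nat \<Rightarrow> nat \<Rightarrow> nat \<Rightarrow> bool" where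
  "certifies Q e x s \<longleftrightarrow>
     certificate Q (set_decode (\<pi>1 s)) \<and> triple e x (\<pi>2 s) \<in> set_decode (\<pi>1 s)"

abbreviation conv :: "(nat \<Rightarrow> nat) \<Rightarrow> nat \<Rightarrow> nat \<Rightarrow> nat \<Rightarrow> bool" where
  "conv f \<equiv> certifies (\<lambda>a b. b = f a)"

lemma conv_sound: "conv f (prog_index p) x s \<Longrightarrow> eval f p x (\<pi>2 s)"
  unfolding certifies_def using certificate_sound[of "\<lambda>a b. b = f a"] by blast

lemma conv_complete:
  assumes "eval f p x y"
  shows "\<exists>s. conv f (prog_index p) x s"
proof -
  obtain S where "finite S" "certificate (\<lambda>a b. b = f a) S" "triple (prog_index p) x y \<in> S"
    using certificate_complete[OF assms] by blast
  then have "conv f (prog_index p) x (prod_encode (set_encode S, y))"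
    by (simp add: certifies_def)
  then show ?thesis by blast
qed

lemma conv_iff: "(\<exists>s. conv f (prog_index p) x s) \<longleftrightarrow> (\<exists>y. eval f p x y)"
  using conv_sound conv_complete by blast

lemma ce_set_conv: "x \<in> ce_set f (prog_index p) \<longleftrightarrow> (\<exists>s. conv f (prog_index p) x s)"
  by (simp add: ce_set_def Phi_prog_index conv_iff)

text \<open>The value occurs in a coded triple, hence lies below the code of the set. Both halves of
  the theorem compare values with witnesses through this inequality.\<close>

lemma conv_value_less: "conv f e x s \<Longrightarrow> \<pi>2 s < s"
proof -
  assume "conv f e x s"
  then have "\<pi>2 s < \<pi>1 s" using triple_bound(3) unfolding certifies_def by blast
  also have "\<pi>1 s \<le> s" using le_prod_encode_1[of "\<pi>1 s" "\<pi>2 s"] by simp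
  finally show ?thesis .
qed

lemma decfn_certifies:
  assumes Q: "decfn (\<lambda>X z. Q X (\<pi>1 z) (\<pi>1 (\<pi>2 z)) (\<pi>2 (\<pi>2 z)))"
    and "recfn E" "recfn A" "recfn S"
  shows "decfn (\<lambda>X x. certifies (Q X x) (E X x) (A X x) (S X x))"
  unfolding certifies_def triple_def
  by (intro recfn_intros decfn_certificate[OF _ Q] assms(2-))

lemma decfn_conv0:
  assumes "recfn E" "recfn A" "recfn S"
  shows "decfn (\<lambda>X x. conv (\<lambda>_. 0) (E X x) (A X x) (S X x))"
  by (rule decfn_certifies[where Q = "\<lambda>X x a b. b = 0", OF _ assms]) (intro recfn_intros)

lemma decfn_conv:
  assumes "recfn E" "recfn A" "recfn S"
  shows "decfn (\<lambda>X x. conv X (E X x) (A X x) (S X x))"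
  by (rule decfn_certifies[where Q = "\<lambda>X x a b. b = X a", OF _ assms]) (intro recfn_intros)

text \<open>Binary strings of length \<open>n\<close> are encoded by the numbers below \<open>2 ^ n\<close>.\<close>

definition segment :: "(nat \<Rightarrow> bool) \<Rightarrow> nat \<Rightarrow> nat" where
  "segment X n = set_encode {i. i < n \<and> X i}"

lemma set_decode_segment: "set_decode (segment X n) = {i. i < n \<and> X i}"
  by (simp add: segment_def)

lemma set_encode_less_power:
  assumes "A \<subseteq> {..<n}"
  shows "set_encode A < 2 ^ n"
proof -
  have "set_encode A \<le> (\<Sum>i<n. 2 ^ i)"
    unfolding set_encode_def by (rule sum_mono2) (use assms in auto)
  also have "(\<Sum>i<n. 2 ^ i) < (2::nat) ^ n"
    by (induction n) auto
  finally show ?thesis .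
qed

lemma segment_less: "segment X n < 2 ^ n"
  unfolding segment_def by (rule set_encode_less_power) auto

lemma less_power_set_decode: "u < 2 ^ n \<Longrightarrow> i \<in> set_decode u \<Longrightarrow> i < n"
proof (rule ccontr)
  assume u: "u < 2 ^ n" and i: "i \<in> set_decode u" and "\<not> i < n"
  then have "(2::nat) ^ n \<le> 2 ^ i" by simp
  with u have "u < 2 ^ i" by linarith
  then have "u div 2 ^ i = 0" by simp
  with i show False by (simp add: set_decode_def)
qed

text \<open>Queries at or beyond \<open>n\<close> get no answer, so a certificate for the string
  remains valid for every sequence extending it.\<close>

definition string_oracle :: "nat \<Rightarrow> nat \<Rightarrow> nat \<Rightarrow> nat \<Rightarrow> bool" where
  "string_oracle n u a b \<longleftrightarrow> a < n \<and> b = of_bool (a \<in> set_decode u)"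

lemma string_oracle_segment: "string_oracle n (segment X n) a b \<longleftrightarrow> a < n \<and> b = char_fun X a"
  by (auto simp: string_oracle_def set_decode_segment char_fun_def)

lemma certifies_segment_conv:
  "certifies (string_oracle n (segment X n)) e x s \<Longrightarrow> conv (char_fun X) e x s"
  unfolding certifies_def by (auto elim!: certificate_weaken simp: string_oracle_segment)

text \<open>All queries are recorded in the certificate and thus lie below its code
  \<open>\<pi>1 s\<close>; a segment of at least that length answers them.\<close>

lemma conv_certifies_segment:
  "conv (char_fun X) e x s \<Longrightarrow> \<pi>1 s \<le> n \<Longrightarrow> certifies (string_oracle n (segment X n)) e x s"
  unfolding certifies_def
  by (auto elim!: certificate_weaken simp: string_oracle_segment dest: triple_bound(2))

section \<open>Fair coin measure of events decided by finitely many bits\<close>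

interpretation fair_coin: product_prob_space "\<lambda>_. measure_pmf (bernoulli_pmf (1/2))" "UNIV :: nat set"
  rewrites "PiM UNIV (\<lambda>_::nat. measure_pmf (bernoulli_pmf (1/2))) = fair_coin"
  by unfold_locales (simp add: fair_coin_def)

lemma space_fair_coin [simp]: "space fair_coin = UNIV"
  by (simp add: fair_coin_def space_PiM)

lemma emeasure_fair_coin_cylinder:
  "emeasure fair_coin {X. \<forall>i<n. X i = v i} = ennreal ((1/2) ^ n)"
proof -
  have half: "emeasure (measure_pmf (bernoulli_pmf (1/2))) {b} = ennreal (1/2)" for b
    by (cases b) (simp_all add: emeasure_pmf_single)
  have "emeasure fair_coin {X. \<forall>i<n. X i = v i} = (\<Prod>i<n. ennreal (1/2))"
    using fair_coin.emeasure_PiM_Collect[of "{..<n}" "\<lambda>i. {v i}"] unfolding half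
    by (simp add: Ball_def)
  also have "\<dots> = ennreal ((1/2) ^ n)"
    unfolding prod_constant by (subst ennreal_power) simp_all
  finally show ?thesis .
qed

lemma sets_fair_coin_cylinder: "{X. \<forall>i<n. X i = v i} \<in> sets fair_coin"
\<comment> \<open>A non-measurable set has \<open>emeasure\<close> 0 by convention, so a nonzero
  value proves measurability.\<close>
proof (rule emeasure_neq_0_sets)
  show "emeasure fair_coin {X. \<forall>i<n. X i = v i} \<noteq> 0"
    unfolding emeasure_fair_coin_cylinder by simp
qed

lemma segment_eq_iff:
  assumes "u < 2 ^ n"
  shows "segment X n = u \<longleftrightarrow> (\<forall>i<n. X i = (i \<in> set_decode u))"
proof -
  have "segment X n = u \<longleftrightarrow> {i. i < n \<and> X i} = set_decode u"
    by (metis set_decode_segment set_decode_inverse)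
  also have "\<dots> \<longleftrightarrow> (\<forall>i<n. X i = (i \<in> set_decode u))"
    using less_power_set_decode[OF assms] by blast
  finally show ?thesis .
qed

lemma segment_predicate_eq_UN:
  "{X. P (segment X n)} = (\<Union>u\<in>{u. u < 2 ^ n \<and> P u}. {X. \<forall>i<n. X i = (i \<in> set_decode u)})"
proof -
  have "{X. P (segment X n)} = (\<Union>u\<in>{u. u < 2 ^ n \<and> P u}. {X. segment X n = u})"
    using segment_less by blast
  also have "\<dots> = (\<Union>u\<in>{u. u < 2 ^ n \<and> P u}. {X. \<forall>i<n. X i = (i \<in> set_decode u)})"
    by (intro SUP_cong refl) (simp add: segment_eq_iff)
  finally show ?thesis .
qed

lemma sets_fair_coin_segment: "{X. P (segment X n)} \<in> sets fair_coin"
  unfolding segment_predicate_eq_UN by (intro sets.finite_UN sets_fair_coin_cylinder) auto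

lemma emeasure_fair_coin_segment:
  "emeasure fair_coin {X. P (segment X n)} = ennreal (card {u. u < 2 ^ n \<and> P u} / 2 ^ n)"
proof -
  let ?I = "{u. u < 2 ^ n \<and> P u}" and ?C = "\<lambda>u. {X. \<forall>i<n. X i = (i \<in> set_decode u)}"
  have C: "?C u = {X. segment X n = u}" if "u \<in> ?I" for u
    using segment_eq_iff[of u n] that by simp
  have disj: "disjoint_family_on ?C ?I"
    unfolding disjoint_family_on_def
  proof (intro ballI impI)
    fix u v assume "u \<in> ?I" "v \<in> ?I" "u \<noteq> v"
    then show "?C u \<inter> ?C v = {}"
      unfolding C[OF \<open>u \<in> ?I\<close>] C[OF \<open>v \<in> ?I\<close>] by blast
  qed
  have "emeasure fair_coin {X. P (segment X n)} = (\<Sum>u\<in>?I. emeasure fair_coin (?C u))"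
    unfolding segment_predicate_eq_UN
    by (rule sum_emeasure[symmetric]) (use disj in \<open>auto intro: sets_fair_coin_cylinder\<close>)
  also have "\<dots> = ennreal (card ?I / 2 ^ n)"
    by (simp add: emeasure_fair_coin_cylinder power_one_over ennreal_of_nat_eq_real_of_nat
        flip: ennreal_mult)
  finally show ?thesis .
qed

text \<open>The events that length \<open>n\<close> does not yet certify halting decrease to a null
  set. Their measure is a count of strings over \<open>2 ^ n\<close>, so the search for a sufficient
  \<open>n\<close> is computable and always succeeds.\<close>

lemma uniform_halting_bound:
  assumes halt: "\<And>k. AE X in fair_coin. \<exists>y. eval (char_fun X) p k y"
  shows "\<exists>g B. computable g \<and> (\<forall>k. B k \<in> sets fair_coin \<and>
      emeasure fair_coin (B k) \<le> ennreal ((1/2) ^ (k + c)) \<and>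
      (\<forall>X. X \<notin> B k \<longrightarrow> (\<exists>s<g k. conv (char_fun X) (prog_index p) k s)))"
proof -
  let ?e = "prog_index p"
  define good where "good k n u \<longleftrightarrow> (\<exists>s<n. certifies (string_oracle n u) ?e k s)" for k n u
  \<comment> \<open>The measure bound \<open>(1/2) ^ (k + c)\<close> on uncertified strings, cleared
    of fractions so that it is decidable on natural numbers.\<close>
  define enough where
    "enough k n \<longleftrightarrow> card {u. u < 2 ^ n \<and> \<not> good k n u} * 2 ^ (k + c) \<le> 2 ^ n" for k n
  define g where "g k = (LEAST n. enough k n)" for k
  define B where "B k n = {X. \<not> good k n (segment X n)}" for k n
  have sets_B: "B k n \<in> sets fair_coin" for k n
    unfolding B_def by (rule sets_fair_coin_segment)
  have emeasure_B: "emeasure fair_coin (B k n) = ennreal (card {u. u < 2 ^ n \<and> \<not> good k n u} / 2 ^ n)"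
    for k n
    unfolding B_def by (rule emeasure_fair_coin_segment)
  have good_mono: "good k m (segment X m)" if "good k n (segment X n)" "n \<le> m" for k n m X
  proof -
    from that(1) obtain s where "s < n" "certifies (string_oracle n (segment X n)) ?e k s"
      unfolding good_def by blast
    moreover from this(2) have "certifies (string_oracle m (segment X m)) ?e k s"
      using that(2) unfolding certifies_def
      by (auto elim!: certificate_weaken simp: string_oracle_segment)
    ultimately show ?thesis
      using that(2) unfolding good_def by (meson order.strict_trans2)
  qed
  have ex: "\<exists>n. enough k n" for k
  proof -
    have "decseq (B k)"
      unfolding B_def decseq_def using good_mono by blast
    then have "(\<lambda>n. emeasure fair_coin (B k n)) \<longlonglongrightarrow> emeasure fair_coin (\<Inter>n. B k n)"
      by (intro Lim_emeasure_decseq) (auto simp: sets_B emeasure_B)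
    moreover have "emeasure fair_coin (\<Inter>n. B k n) = 0"
    proof -
      have "AE X in fair_coin. X \<notin> (\<Inter>n. B k n)"
        using halt[of k]
      proof eventually_elim
        case (elim X)
        then obtain s where s: "conv (char_fun X) ?e k s"
          using conv_complete by blast
        \<comment> \<open>The length must exceed the witness \<open>s\<close> and reach its
          certificate code, which bounds all queries.\<close>
        have "good k (Suc (max s (\<pi>1 s))) (segment X (Suc (max s (\<pi>1 s))))"
          unfolding good_def by (intro exI[of _ s] conjI conv_certifies_segment[OF s]) auto
        then show ?case unfolding B_def by blast
      qed
      then show ?thesis
        by (rule AE_iff_measurable[THEN iffD1, rotated 2])
          (auto intro!: sets.countable_INT simp: sets_B simp del: INT_iff Inter_iff)
    qed
    ultimately have "(\<lambda>n. emeasure fair_coin (B k n)) \<longlonglongrightarrow> 0" by simp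
    then have "\<forall>\<^sub>F n in sequentially. emeasure fair_coin (B k n) < ennreal ((1/2) ^ (k + c))"
      by (rule order_tendstoD) simp
    then obtain n where "emeasure fair_coin (B k n) < ennreal ((1/2) ^ (k + c))"
      by (auto simp: eventually_sequentially)
    then have "card {u. u < 2 ^ n \<and> \<not> good k n u} / 2 ^ n < (1/2::real) ^ (k + c)"
      unfolding emeasure_B by (simp add: ennreal_less_iff)
    then have "real (card {u. u < 2 ^ n \<and> \<not> good k n u} * 2 ^ (k + c)) < real (2 ^ n)"
      by (simp add: power_one_over field_simps)
    then have "enough k n" unfolding enough_def by linarith
    then show ?thesis ..
  qed
  then have enough_g: "enough k (g k)" for k
    unfolding g_def by (rule LeastI_ex)
  have "recfn (\<lambda>X k. g k)"
    unfolding g_def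
  proof (rule recfn_Least[where P = "\<lambda>_. enough", OF _ ex])
    show "decfn (\<lambda>X z. enough (\<pi>1 z) (\<pi>2 z))"
      unfolding enough_def good_def
      \<comment> \<open>The variables are coded as \<open>(((k, n), u), s)\<close>; the projections
        pick out \<open>n\<close> and \<open>u\<close>.\<close>
      by (intro recfn_intros decfn_certifies[where Q = "\<lambda>X z. string_oracle (\<pi>2 (\<pi>1 (\<pi>1 z))) (\<pi>2 (\<pi>1 z))"])
        (unfold string_oracle_def, intro recfn_intros)
  qed
  then have "computable g" by (rule recfn_imp_computable)
  moreover have "emeasure fair_coin (B k (g k)) \<le> ennreal ((1/2) ^ (k + c))" for k
  proof -
    have "real (card {u. u < 2 ^ g k \<and> \<not> good k (g k) u} * 2 ^ (k + c)) \<le> real (2 ^ g k)"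
      using enough_g[of k] unfolding enough_def by (simp only: of_nat_le_iff)
    then show ?thesis
      unfolding emeasure_B by (intro ennreal_leI) (simp add: power_one_over field_simps)
  qed
  moreover have "\<exists>s<g k. conv (char_fun X) ?e k s" if "X \<notin> B k (g k)" for X k
    using that certifies_segment_conv unfolding B_def good_def by blast
  ultimately show ?thesis
    using sets_B by (intro exI[of _ g] exI[of _ "\<lambda>k. B k (g k)"]) blast
qed

section \<open>Failure at level one\<close>

text \<open>An iterated tail on list codes, where a nonempty list has code
  \<open>Suc (prod_encode (x, l))\<close>. As \<open>\<pi>2 0 = 0\<close>, the code 0 of the empty
  list is a fixed point.\<close>

definition suffix_code :: "nat \<Rightarrow> nat \<Rightarrow> nat" where
  "suffix_code l i = rec_nat l (\<lambda>_ y. \<pi>2 (y - 1)) i"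

lemma suffix_code_list_encode: "suffix_code (list_encode xs) i = list_encode (drop i xs)"
proof (induction i)
  case (Suc i)
  have zero: "\<pi>2 0 = 0"
    using le_prod_encode_2[of "\<pi>2 0" "\<pi>1 0"] by simp
  have "drop (Suc i) xs = tl (drop i xs)"
    by (simp add: drop_Suc tl_drop)
  with Suc show ?case
    by (cases "drop i xs") (simp_all add: suffix_code_def zero)
qed (simp add: suffix_code_def)

lemma length_le_list_encode: "length xs \<le> list_encode xs"
proof (induction xs)
  case (Cons x xs)
  then show ?case using le_prod_encode_2[of "list_encode xs" x] by simp
qed simp

text \<open>The bound \<open>l\<close> on positions suffices because a list is no longer than its
  code; past the end the suffix code is 0 and the condition is void.\<close>

definition in_cylinder :: "(nat \<Rightarrow> nat) \<Rightarrow> nat \<Rightarrow> bool" where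
  "in_cylinder f l \<longleftrightarrow> (\<forall>i<l. suffix_code l i = 0 \<or> f i = \<pi>1 (suffix_code l i - 1))"

lemma in_cylinder_list_encode:
  "in_cylinder f (list_encode xs) \<longleftrightarrow> map f [0..<length xs] = xs"
proof -
  have step: "suffix_code (list_encode xs) i = 0 \<or> f i = \<pi>1 (suffix_code (list_encode xs) i - 1)
      \<longleftrightarrow> (i < length xs \<longrightarrow> f i = xs ! i)" for i
  proof (cases "i < length xs")
    case True
    then show ?thesis by (simp add: suffix_code_list_encode Cons_nth_drop_Suc[symmetric])
  qed (simp add: suffix_code_list_encode)
  show ?thesis
    unfolding in_cylinder_def step list_eq_iff_nth_eq
    using length_le_list_encode[of xs] by auto
qed

text \<open>One unfolding of membership, with \<open>S\<close> holding the answers for smaller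
  indices. Complements use \<open>S\<close> negatively, so, unlike for computations, a certificate
  has to settle every index up to \<open>d\<close>. The bound \<open>Suc d\<close> admits
  \<open>l = d = 0\<close>.\<close>

definition class_step :: "(nat \<Rightarrow> nat) \<Rightarrow> nat set \<Rightarrow> nat \<Rightarrow> bool" where
  "class_step f S d \<longleftrightarrow>
     (\<exists>l<Suc d. d = 3 * l \<and> in_cylinder f l) \<or>
     (\<exists>a<d. d = 3 * a + 1 \<and> a \<notin> S) \<or>
     (\<exists>a<d. \<exists>b<d. d = 3 * prod_encode (a, b) + 2 \<and> a \<in> S \<and> b \<in> S)"

lemma mod3_neq:
  fixes a b :: nat
  shows "3 * a \<noteq> 3 * b + 1" "3 * a \<noteq> 3 * b + 2" "3 * a + 1 \<noteq> 3 * b" "3 * a + 1 \<noteq> 3 * b + 2"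
    "3 * a + 2 \<noteq> 3 * b" "3 * a + 2 \<noteq> 3 * b + 1"
  by presburger+

lemma mod3_cases:
  obtains l where "d = 3 * l" | a where "d = 3 * a + 1" | m where "d = 3 * m + (2::nat)"
proof -
  have "d = 3 * (d div 3) \<or> d = 3 * (d div 3) + 1 \<or> d = 3 * (d div 3) + 2"
    by presburger
  then show thesis using that by blast
qed

lemma class_step_iff:
  "class_step f S (3 * l) \<longleftrightarrow> in_cylinder f l"
  "class_step f S (3 * a + 1) \<longleftrightarrow> a \<notin> S"
  "class_step f S (3 * prod_encode (a, b) + 2) \<longleftrightarrow> a \<in> S \<and> b \<in> S"
proof -
  have "a < 3 * prod_encode (a, b) + 2" "b < 3 * prod_encode (a, b) + 2"
    using le_prod_encode_1[of a b] le_prod_encode_2[of b a] by linarith+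
  then show "class_step f S (3 * prod_encode (a, b) + 2) \<longleftrightarrow> a \<in> S \<and> b \<in> S"
    by (simp only: class_step_def mod3_neq add_right_cancel mult_cancel1 prod_encode_eq prod.inject
        simp_thms) auto
  have "l < Suc (3 * l)" "a < 3 * a + 1" by simp_all
  then show "class_step f S (3 * l) \<longleftrightarrow> in_cylinder f l" "class_step f S (3 * a + 1) \<longleftrightarrow> a \<notin> S"
    by (simp_all only: class_step_def mod3_neq add_right_cancel mult_cancel1
        simp_thms) auto
qed

text \<open>The residue modulo 3 names the constructor, and list and pair codes are onto. Hence a
  recursion on indices meets no junk.\<close>

lemma bool_comb_index_surj: "\<exists>b. bool_comb_index b = d"
proof (induction d rule: less_induct)
  case (less d)
  consider l where "d = 3 * l" | a where "d = 3 * a + 1" | m where "d = 3 * m + 2"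
    by (rule mod3_cases)
  then show ?case
  proof cases
    case 1
    then have "bool_comb_index (BCylinder (list_decode l)) = d" by simp
    then show ?thesis ..
  next
    case (2 a)
    with less[of a] obtain b where "bool_comb_index b = a" by auto
    with 2 have "bool_comb_index (BCompl b) = d" by simp
    then show ?thesis ..
  next
    case (3 m)
    obtain a b where m: "m = prod_encode (a, b)"
      by (metis prod.collapse prod_decode_inverse)
    then have "a < d" "b < d"
      using 3 le_prod_encode_1[of a b] le_prod_encode_2[of b a] by linarith+
    with less obtain x y where "bool_comb_index x = a" "bool_comb_index y = b" by metis
    with 3 m have "bool_comb_index (BInter x y) = d" by simp
    then show ?thesis ..
  qed
qed

lemma Pi_class_0_bool_comb_index: "Pi_class 0 (bool_comb_index b) = bool_comb_class b"
  by (auto dest: injD[OF inj_bool_comb_index])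

lemma Pi_class_0_simps:
  "f \<in> Pi_class 0 (3 * l) \<longleftrightarrow> in_cylinder f l"
  "f \<in> Pi_class 0 (3 * a + 1) \<longleftrightarrow> f \<notin> Pi_class 0 a"
  "f \<in> Pi_class 0 (3 * prod_encode (a, b) + 2) \<longleftrightarrow> f \<in> Pi_class 0 a \<and> f \<in> Pi_class 0 b"
proof -
  show "f \<in> Pi_class 0 (3 * l) \<longleftrightarrow> in_cylinder f l"
    using Pi_class_0_bool_comb_index[of "BCylinder (list_decode l)"]
      in_cylinder_list_encode[of f "list_decode l"] by (simp del: Pi_class.simps)
  obtain x y where xy: "bool_comb_index x = a" "bool_comb_index y = b"
    using bool_comb_index_surj by metis
  show "f \<in> Pi_class 0 (3 * a + 1) \<longleftrightarrow> f \<notin> Pi_class 0 a"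
    using Pi_class_0_bool_comb_index[of "BCompl x"] Pi_class_0_bool_comb_index[of x] xy
    by (simp del: Pi_class.simps)
  show "f \<in> Pi_class 0 (3 * prod_encode (a, b) + 2) \<longleftrightarrow> f \<in> Pi_class 0 a \<and> f \<in> Pi_class 0 b"
    using Pi_class_0_bool_comb_index[of "BInter x y"] Pi_class_0_bool_comb_index[of x]
      Pi_class_0_bool_comb_index[of y] xy
    by (simp del: Pi_class.simps)
qed

lemma Pi_class_0_class_step: "f \<in> Pi_class 0 d \<longleftrightarrow> class_step f {a. f \<in> Pi_class 0 a} d"
proof -
  consider l where "d = 3 * l" | a where "d = 3 * a + 1" | m where "d = 3 * m + 2"
    by (rule mod3_cases)
  then show ?thesis
  proof cases
    case (3 m)
    obtain a b where "m = prod_encode (a, b)"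
      by (metis prod.collapse prod_decode_inverse)
    with 3 show ?thesis by (simp only: Pi_class_0_simps class_step_iff mem_Collect_eq)
  qed (simp_all only: Pi_class_0_simps class_step_iff mem_Collect_eq)
qed

lemma class_step_cong: "S \<inter> {..<d} = T \<inter> {..<d} \<Longrightarrow> class_step f S d \<longleftrightarrow> class_step f T d"
  unfolding class_step_def by blast

text \<open>
  Membership in \<open>Pi_class 0\<close> is determined by a recursion on the index, so a finite set satisfying
  the recursion up to \<open>d\<close> is correct up to \<open>d\<close>.
\<close>

definition class_certificate :: "(nat \<Rightarrow> nat) \<Rightarrow> nat \<Rightarrow> nat \<Rightarrow> bool" where
  "class_certificate f d c \<longleftrightarrow>
     d \<in> set_decode c \<and> (\<forall>a<Suc d. a \<in> set_decode c \<longleftrightarrow> class_step f (set_decode c) a)"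

lemma class_certificate_iff: "(\<exists>c. class_certificate f d c) \<longleftrightarrow> f \<in> Pi_class 0 d"
proof
  assume "\<exists>c. class_certificate f d c"
  then obtain c where d: "d \<in> set_decode c"
    and step: "\<And>a. a \<le> d \<Longrightarrow> a \<in> set_decode c \<longleftrightarrow> class_step f (set_decode c) a"
    unfolding class_certificate_def less_Suc_eq_le by blast
  have "a \<in> set_decode c \<longleftrightarrow> f \<in> Pi_class 0 a" if "a \<le> d" for a
    using that
  proof (induction a rule: less_induct)
    case (less a)
    then have "set_decode c \<inter> {..<a} = {b. f \<in> Pi_class 0 b} \<inter> {..<a}" by auto
    from class_step_cong[OF this] step[OF less.prems] Pi_class_0_class_step show ?case by metis
  qed
  with d show "f \<in> Pi_class 0 d" by blast
next
  assume f: "f \<in> Pi_class 0 d"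
  define S where "S = {a. a \<le> d \<and> f \<in> Pi_class 0 a}"
  have S: "set_decode (set_encode S) = S"
    by (simp add: S_def)
  have "a \<in> S \<longleftrightarrow> class_step f S a" if "a \<le> d" for a
  proof -
    have "S \<inter> {..<a} = {b. f \<in> Pi_class 0 b} \<inter> {..<a}"
      using that by (auto simp: S_def)
    from class_step_cong[OF this] Pi_class_0_class_step that show ?thesis
      unfolding S_def by blast
  qed
  then have "class_certificate f d (set_encode S)"
    using f unfolding class_certificate_def S by (simp add: S_def less_Suc_eq_le)
  then show "\<exists>c. class_certificate f d c" ..
qed

lemma decfn_class_certificate:
  assumes "recfn D" "recfn C"
  shows "decfn (\<lambda>X x. class_certificate X (D X x) (C X x))"
proof -
  have suffix: "recfn (\<lambda>X x. suffix_code (A X x) (B X x))" if "recfn A" "recfn B" for A B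
    unfolding suffix_code_def by (intro recfn_intros that)
  have "decfn (\<lambda>X z. class_certificate X (\<pi>1 z) (\<pi>2 z))"
    unfolding class_certificate_def class_step_def in_cylinder_def
    by (intro recfn_intros suffix)
  from recfn_comp2[where F = "\<lambda>X d c. of_bool (class_certificate X d c)", OF this assms]
  show ?thesis .
qed

lemma ce_set_decidable_search:
  "\<exists>R. decfn (\<lambda>X z. R (\<pi>1 z) (\<pi>2 z)) \<and> (\<forall>x. x \<in> ce_set (\<lambda>_. 0) e \<longleftrightarrow> (\<exists>s. R x s))"
proof (cases "\<exists>q. prog_index q = e")
  case True
  then obtain q where "prog_index q = e" ..
  then show ?thesis
    using ce_set_conv[of _ "\<lambda>_. 0" q]
    by (intro exI[of _ "conv (\<lambda>_. 0) e"] conjI decfn_conv0 recfn_intros) auto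
next
  case False
  then show ?thesis
    using recfn_const[of 0] by (intro exI[of _ "\<lambda>_ _. False"]) (simp add: ce_set_def Phi_def)
qed

section \<open>Measurability and randomness almost everywhere\<close>

lemma sets_fair_coin_Pi_class_0: "{X. char_fun X \<in> Pi_class 0 d} \<in> sets fair_coin"
proof -
  obtain b where b: "bool_comb_index b = d" using bool_comb_index_surj by blast
  have "{X. char_fun X \<in> bool_comb_class b} \<in> sets fair_coin"
  proof (induction b)
    case (BCylinder s)
    have "map (char_fun X) [0..<length s] =
        map (\<lambda>i. of_bool (i \<in> set_decode (segment X (length s)))) [0..<length s]" for X
      by (simp add: char_fun_def set_decode_segment)
    then show ?case
      using sets_fair_coin_segment[where n = "length s" and
          P = "\<lambda>u. map (\<lambda>i. of_bool (i \<in> set_decode u)) [0..<length s] = s"]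
      by (simp only: bool_comb_class.simps mem_Collect_eq)
  next
    case (BCompl b)
    then show ?case using sets.compl_sets[OF BCompl] by (simp add: Compl_eq Diff_eq)
  next
    case (BInter b c)
    then show ?case using sets.Int[OF BInter] by (simp add: Int_def)
  qed
  then show ?thesis
    using b Pi_class_0_bool_comb_index by metis
qed

lemma sets_fair_coin_Pi_class_1: "{X. char_fun X \<in> Pi_class 1 e} \<in> sets fair_coin"
proof -
  have "{X. char_fun X \<in> Pi_class 1 e} =
      UNIV - (\<Union>d\<in>ce_set (\<lambda>_. 0) e. {X. char_fun X \<in> Pi_class 0 d})"
    unfolding One_nat_def Pi_class.simps(2) by blast
  also have "\<dots> \<in> sets fair_coin"
    using sets.compl_sets[OF sets.countable_UN''[OF countableI_type sets_fair_coin_Pi_class_0]]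
    by simp
  finally show ?thesis .
qed

text \<open>The c.e. set consists of \<open>3 * d + 1\<close> alone, the index of the complement,
  and a Pi^0_1 class complements what is enumerated.\<close>

lemma Pi_class_0_eq_Pi_class_1: "\<exists>e. Pi_class 0 d = Pi_class 1 e"
proof -
  have "decfn (\<lambda>X z. \<pi>1 z = 3 * d + 1)"
    by (intro recfn_intros)
  from search_prog[where P = "\<lambda>X x y. x = 3 * d + 1", OF this] obtain p where
    p: "\<And>X x y. eval X p x y \<longleftrightarrow> x = 3 * d + 1 \<and> (\<forall>m<y. x \<noteq> 3 * d + 1)"
    by blast
  have "ce_set (\<lambda>_. 0) (prog_index p) = {3 * d + 1}"
    using search_prog_halts[OF p] unfolding ce_set_def Phi_prog_index by auto
  then have "Pi_class 1 (prog_index p) = - Pi_class 0 (3 * d + 1)"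
    unfolding One_nat_def Pi_class.simps(2) by (simp only: UN_simps UN_singleton) blast
  also have "\<dots> = Pi_class 0 d"
    using Pi_class_0_simps(2) by blast
  finally show ?thesis by metis
qed

lemma sets_fair_coin_Sigma1_seq: "Sigma1_seq Z e n \<in> sets fair_coin"
proof -
  have "map (char_fun X) [0..<k] = map (\<lambda>i. of_bool (i \<in> set_decode (segment X k))) [0..<k]" for X k
    by (simp add: char_fun_def set_decode_segment)
  then have "Sigma1_seq Z e n = (\<Union>k. {X. prod_encode (n, list_encode
      (map (\<lambda>i. of_bool (i \<in> set_decode (segment X k))) [0..<k])) \<in> ce_set Z e})"
    unfolding Sigma1_seq_def by (simp only:) blast
  then show ?thesis
    by (simp only:) (intro sets.countable_UN'' countableI_type sets_fair_coin_segment)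
qed

text \<open>Each test captures a null set, and tests are countably many because each has an index
  \<open>e\<close>.\<close>

lemma AE_martin_loef_random: "AE X in fair_coin. martin_loef_random Z X"
proof -
  have "AE X in fair_coin. martin_loef_test Z (Sigma1_seq Z e) \<longrightarrow> X \<notin> (\<Inter>n. Sigma1_seq Z e n)" for e
  proof (cases "martin_loef_test Z (Sigma1_seq Z e)")
    case True
    let ?N = "\<Inter>n. Sigma1_seq Z e n"
    have N: "?N \<in> sets fair_coin"
      by (intro sets.countable_INT) (auto simp: sets_fair_coin_Sigma1_seq)
    have "emeasure fair_coin ?N \<le> ennreal ((1/2) ^ n)" for n
    proof -
      have "emeasure fair_coin ?N \<le> emeasure fair_coin (Sigma1_seq Z e n)"
        by (intro emeasure_mono sets_fair_coin_Sigma1_seq) blast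
      also have "\<dots> \<le> ennreal ((1/2) ^ n)"
        using True unfolding martin_loef_test_def by blast
      finally show ?thesis .
    qed
    moreover have "(\<lambda>n. ennreal ((1/2) ^ n)) \<longlonglongrightarrow> ennreal 0"
      by (intro tendsto_ennrealI LIMSEQ_realpow_zero) auto
    ultimately have "emeasure fair_coin ?N \<le> ennreal 0"
      by (intro LIMSEQ_le_const) auto
    then have "?N \<in> null_sets fair_coin" using N by (auto simp: null_sets_def)
    from AE_not_in[OF this] show ?thesis by simp
  qed simp
  then have "AE X in fair_coin. \<forall>e. martin_loef_test Z (Sigma1_seq Z e) \<longrightarrow>
      X \<notin> (\<Inter>n. Sigma1_seq Z e n)"
    by (simp only: AE_all_countable) blast
  then show ?thesis
  proof eventually_elim
    case (elim X)
    show ?case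
      unfolding martin_loef_random_def
    proof (intro allI impI)
      fix U assume U: "martin_loef_test Z U"
      then obtain e where "U = Sigma1_seq Z e" unfolding martin_loef_test_def by blast
      with elim U show "X \<notin> (\<Inter>n. U n)" by blast
    qed
  qed
qed

lemma suminf_half_powers: "(\<Sum>k. ennreal ((1/2) ^ (k + Suc c))) = ennreal ((1/2) ^ c)"
proof (rule suminf_ennreal_eq)
  show "(\<lambda>k. (1/2) ^ (k + Suc c)) sums ((1/2::real) ^ c)"
    using sums_mult2[OF power_half_series, of "(1/2) ^ c"] by (simp add: power_add mult_ac)
qed simp

section \<open>The measure argument against Pi^0_1 covers\<close>

lemma not_reducible_Pi1_classes:
  fixes V :: "nat \<Rightarrow> (nat \<Rightarrow> nat) set"
  assumes V: "\<And>i. \<exists>d. V i = Pi_class 1 d"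
    and cover: "two_randoms \<subseteq> (\<Union>i. V i)"
    and red: "\<And>i f. f \<in> two_randoms \<inter> V i \<Longrightarrow> \<exists>g\<in>non_computably_dominated. Phi_total (e i) f g"
  shows False
proof -
  have random: "AE X in fair_coin. two_random X"
    unfolding two_random_def by (rule AE_martin_loef_random)
  have "\<exists>i. \<not> (AE X in fair_coin. char_fun X \<notin> V i)"
  proof (rule ccontr)
    assume "\<not> ?thesis"
    then have "\<forall>i. AE X in fair_coin. char_fun X \<notin> V i" by blast
    then have "AE X in fair_coin. \<forall>i. char_fun X \<notin> V i"
      by (rule AE_all_countable[THEN iffD2])
    with random have "AE X in fair_coin. False"
    proof eventually_elim
      case (elim X)
      then show False using cover unfolding two_randoms_def by blast
    qed
    then show False by simp
  qed
  then obtain i where i: "\<not> (AE X in fair_coin. char_fun X \<notin> V i)" ..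
  obtain d where d: "V i = Pi_class 1 d" using V by blast
  define W where "W = {X. char_fun X \<in> V i}"
  have W: "W \<in> sets fair_coin"
    unfolding W_def d by (rule sets_fair_coin_Pi_class_1)
  have "emeasure fair_coin W \<noteq> 0"
  proof
    assume "emeasure fair_coin W = 0"
    then have "W \<in> null_sets fair_coin" using W by blast
    from AE_not_in[OF this] i show False by (simp add: W_def)
  qed
  moreover have "(\<lambda>n. ennreal ((1/2) ^ n)) \<longlonglongrightarrow> ennreal 0"
    by (intro tendsto_ennrealI LIMSEQ_realpow_zero) auto
  ultimately have "\<forall>\<^sub>F c in sequentially. ennreal ((1/2) ^ c) < emeasure fair_coin W"
    by (intro order_tendstoD(2)) (auto simp: zero_less_iff_neq_zero)
  then obtain c where c: "ennreal ((1/2) ^ c) < emeasure fair_coin W"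
    by (auto simp: eventually_sequentially)
  \<comment> \<open>One 2-random member yields a converging computation, which shows that
    \<open>e i\<close> is the index of a program.\<close>
  have "\<exists>X. two_random X \<and> X \<in> W"
  proof (rule ccontr)
    assume "\<not> ?thesis"
    then have "AE X in fair_coin. char_fun X \<notin> V i"
      using random by (auto simp: W_def elim!: AE_mp)
    with i show False ..
  qed
  then obtain X g where "Phi_total (e i) (char_fun X) g"
    using red[of _ i] unfolding W_def two_randoms_def by blast
  then obtain p where p: "e i = prog_index p"
    unfolding Phi_total_def Phi_def by metis
  obtain R where R: "decfn (\<lambda>X z. R (\<pi>1 z) (\<pi>2 z))"
    "\<And>x. x \<in> ce_set (\<lambda>_. 0) d \<longleftrightarrow> (\<exists>s. R x s)"
    using ce_set_decidable_search[of d] by blast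
  \<comment> \<open>The race: either \<open>s\<close> witnesses convergence of the functional, or it
    packs an index \<open>a\<close> enumerated for the complement, the witness of that enumeration
    and a certificate that \<open>f\<close> lies in \<open>Pi_class 0 a\<close>.\<close>
  define P where "P f k s \<longleftrightarrow> conv f (prog_index p) k s \<or>
      R (\<pi>1 s) (\<pi>1 (\<pi>2 s)) \<and> class_certificate f (\<pi>1 s) (\<pi>2 (\<pi>2 s))" for f k s
  have not_mem: "(\<exists>s. R (\<pi>1 s) (\<pi>1 (\<pi>2 s)) \<and> class_certificate f (\<pi>1 s) (\<pi>2 (\<pi>2 s)))
      \<longleftrightarrow> f \<notin> V i" for f
  proof -
    have "f \<notin> V i \<longleftrightarrow> (\<exists>a s c. R a s \<and> class_certificate f a c)"
      unfolding d One_nat_def Pi_class.simps(2) using R(2) class_certificate_iff by blast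
    also have "\<dots> \<longleftrightarrow> (\<exists>s. R (\<pi>1 s) (\<pi>1 (\<pi>2 s)) \<and> class_certificate f (\<pi>1 s) (\<pi>2 (\<pi>2 s)))"
    proof
      assume "\<exists>a s c. R a s \<and> class_certificate f a c"
      then obtain a s c where "R a s \<and> class_certificate f a c" by blast
      then show "\<exists>s. R (\<pi>1 s) (\<pi>1 (\<pi>2 s)) \<and> class_certificate f (\<pi>1 s) (\<pi>2 (\<pi>2 s))"
        by (intro exI[of _ "prod_encode (a, prod_encode (s, c))"]) simp
    qed blast
    finally show ?thesis by blast
  qed
  have "decfn (\<lambda>X z. P X (\<pi>1 z) (\<pi>2 z))"
    unfolding P_def
    by (intro recfn_intros decfn_conv decfn_class_certificate
        recfn_comp2[where F = "\<lambda>_ a b. of_bool (R a b)", OF R(1)])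
  from search_prog[where P = P, OF this] obtain r where
    r: "\<And>X x y. eval X r x y \<longleftrightarrow> P X x y \<and> (\<forall>m<y. \<not> P X x m)"
    by blast
  have reduce: "\<exists>G\<in>non_computably_dominated. \<forall>k. eval (char_fun X) p k (G k)"
    if "two_random X" "X \<in> W" for X
    using red[of "char_fun X" i] that
    unfolding p W_def two_randoms_def Phi_total_def Phi_prog_index by blast
  have halts: "AE X in fair_coin. \<exists>y. eval (char_fun X) r k y" for k
    using random
  proof eventually_elim
    case (elim X)
    have "\<exists>y. P (char_fun X) k y"
    proof (cases "X \<in> W")
      case True
      with reduce[OF elim] obtain y where "eval (char_fun X) p k y" by blast
      then show ?thesis using conv_complete unfolding P_def by blast
    next
      case False
      then show ?thesis using not_mem[of "char_fun X"] unfolding P_def W_def by blast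
    qed
    then show ?case using search_prog_halts[of r P, OF r] by blast
  qed
  obtain g B where g: "computable g" and B: "\<And>k. B k \<in> sets fair_coin"
    "\<And>k. emeasure fair_coin (B k) \<le> ennreal ((1/2) ^ (k + Suc c))"
    "\<And>k X. X \<notin> B k \<Longrightarrow> \<exists>s<g k. conv (char_fun X) (prog_index r) k s"
    \<comment> \<open>With \<open>Suc c\<close> the errors add up to \<open>(1/2) ^ c\<close>, which
      was chosen below the measure of \<open>W\<close>.\<close>
    using uniform_halting_bound[of r "Suc c", OF halts] by blast
  have "emeasure fair_coin (\<Union>k. B k) \<le> (\<Sum>k. emeasure fair_coin (B k))"
    by (rule emeasure_subadditive_countably) (use B(1) in auto)
  also have "\<dots> \<le> (\<Sum>k. ennreal ((1/2) ^ (k + Suc c)))"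
    by (intro suminf_le B(2)) auto
  also have "\<dots> = ennreal ((1/2) ^ c)"
    by (rule suminf_half_powers)
  also have "\<dots> < emeasure fair_coin W" by (rule c)
  finally have less: "emeasure fair_coin (\<Union>k. B k) < emeasure fair_coin W" .
  have "\<exists>X. two_random X \<and> X \<in> W \<and> X \<notin> (\<Union>k. B k)"
  proof (rule ccontr)
    assume "\<not> ?thesis"
    then have "AE X in fair_coin. X \<in> W \<longrightarrow> X \<in> (\<Union>k. B k)"
      using random by (auto elim!: AE_mp)
    then have "emeasure fair_coin W \<le> emeasure fair_coin (\<Union>k. B k)"
      by (rule emeasure_mono_AE) (use B(1) in auto)
    with less show False by simp
  qed
  then obtain X where X: "two_random X" "X \<in> W" "\<And>k. X \<notin> B k" by blast
  then obtain G where G: "G \<in> non_computably_dominated" "\<And>k. eval (char_fun X) p k (G k)"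
    using reduce by blast
  have "G k \<le> g k" for k
  proof -
    obtain s where s: "s < g k" "conv (char_fun X) (prog_index r) k s"
      using B(3)[OF X(3)] by blast
    from conv_sound[OF s(2)] have "P (char_fun X) k (\<pi>2 s)"
      using r by blast
    then have y: "conv (char_fun X) (prog_index p) k (\<pi>2 s)"
      using not_mem[of "char_fun X"] X(2) unfolding P_def W_def by blast
    \<comment> \<open>Two layers: \<open>\<pi>2 s\<close> is the output of \<open>r\<close>, and
      this output is a witness for \<open>p\<close>, whose value is
      \<open>\<pi>2 (\<pi>2 s)\<close>. The other outcome of the race was excluded by
      \<open>X \<in> W\<close>.\<close>
    have "G k = \<pi>2 (\<pi>2 s)"
      using conv_sound[OF y] G(2) eval_deterministic by blast
    also have "\<dots> < \<pi>2 s" by (rule conv_value_less[OF y])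
    also have "\<dots> < s" by (rule conv_value_less[OF s(2)])
    finally show ?thesis using s(1) by simp
  qed
  with g G(1) show False
    unfolding non_computably_dominated_def computably_dominated_def by blast
qed

lemma not_reducible_fin_0_1:
  assumes "n \<le> 1"
  shows "\<not> reducible_fin n non_computably_dominated two_randoms"
proof
  assume "reducible_fin n non_computably_dominated two_randoms"
  then obtain V :: "nat \<Rightarrow> (nat \<Rightarrow> nat) set" and e h :: "nat \<Rightarrow> nat" where V: "\<And>i. V i = Pi_class n (h i)"
    and cover: "two_randoms \<subseteq> (\<Union>i. V i)"
    and red: "\<And>i f. f \<in> two_randoms \<inter> V i \<Longrightarrow> \<exists>g\<in>non_computably_dominated. Phi_total (e i) f g"
    unfolding reducible_fin_def uniformly_Pi_def by blast
  have "\<exists>d. V i = Pi_class 1 d" for i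
  proof (cases n)
    case 0
    then show ?thesis using V Pi_class_0_eq_Pi_class_1 by simp
  next
    case (Suc m)
    with assms have "n = 1" by simp
    then show ?thesis using V by blast
  qed
  from not_reducible_Pi1_classes[OF this cover red] show False .
qed

section \<open>Success at level two\<close>

text \<open>
  \<open>stage e n = \<langle>j, m\<rangle>\<close> means that before step \<open>n\<close> the parts \<open>0, \<dots>, j - 1\<close> of the partition for \<open>e\<close>
  have seen their computations of \<open>\<phi>\<^sub>e\<close> halt, and that part \<open>j\<close> waits for \<open>\<phi>\<^sub>e(\<langle>e, m\<rangle>)\<close> since step \<open>m\<close>.
\<close>

definition stage :: "nat \<Rightarrow> nat \<Rightarrow> nat" where
  "stage e n = rec_nat (prod_encode (0, 0))
     (\<lambda>n y. if \<exists>t<n. conv (\<lambda>_. 0) e (prod_encode (e, \<pi>2 y)) t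
       then prod_encode (Suc (\<pi>1 y), Suc n) else y) n"

text \<open>\<open>\<pi>2 (stage e n) = n\<close> holds exactly at the steps where a part starts to
  wait. That half is decidable, so the halting problem decides the whole predicate.\<close>

definition stuck :: "nat \<Rightarrow> nat \<Rightarrow> bool" where
  "stuck e n \<longleftrightarrow> \<pi>2 (stage e n) = n \<and> (\<forall>s. \<not> conv (\<lambda>_. 0) e (prod_encode (e, n)) s)"

lemma stage_stuck:
  assumes "stuck e n" "n \<le> m"
  shows "stage e m = stage e n"
  using assms(2)
proof (induction m rule: dec_induct)
  case (step m)
  then show ?case using assms(1) by (simp add: stage_def stuck_def)
qed simp

text \<open>From the earlier step on \<open>stage e\<close> is constant, and its second component
  equals both steps.\<close>

lemma stuck_unique:
  assumes "stuck e m" "stuck e n"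
  shows "m = n"
  using stage_stuck[OF assms(1), of n] stage_stuck[OF assms(2), of m] assms nle_le[of m n]
  unfolding stuck_def by metis

text \<open>Each wait ends once the step counter exceeds a halting witness. The second component
  \<open>n\<close> marks the step at which part \<open>j\<close> starts, where its sequences are
  made to escape.\<close>

lemma stage_reaches_all:
  assumes total: "\<And>x. \<exists>s. conv (\<lambda>_. 0) e x s"
  shows "\<exists>n. stage e n = prod_encode (j, n)"
proof (induction j)
  case 0
  show ?case by (rule exI[of _ 0]) (simp add: stage_def)
next
  case (Suc j)
  then obtain n where n: "stage e n = prod_encode (j, n)" ..
  let ?found = "\<lambda>m. \<exists>t<m. conv (\<lambda>_. 0) e (prod_encode (e, n)) t"
  obtain t where "conv (\<lambda>_. 0) e (prod_encode (e, n)) t" using total by blast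
  then have "n \<le> max n (Suc t) \<and> ?found (max n (Suc t))" by (auto intro!: exI[of _ t])
  then obtain m where m: "n \<le> m \<and> ?found m" and least: "\<And>k. k < m \<Longrightarrow> \<not> (n \<le> k \<and> ?found k)"
    using exists_least_iff[of "\<lambda>m. n \<le> m \<and> ?found m"] by blast
  have "stage e k = prod_encode (j, n)" if "n \<le> k" "k \<le> m" for k
    using that
  proof (induction k rule: dec_induct)
    case (step k)
    then have "stage e k = prod_encode (j, n)" "\<not> ?found k" using least[of k] by auto
    then show ?case by (simp add: stage_def)
  qed (simp add: n)
  from this[of m] m have "stage e (Suc m) = prod_encode (Suc j, Suc m)"
    by (simp add: stage_def)
  then show ?case ..
qed

text \<open>Only the first \<open>m\<close> bits of \<open>j\<close> count. The counter in
  \<open>stage\<close> is unbounded, and this reads it modulo \<open>2 ^ m\<close>, so the parts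
  take turns cyclically.\<close>

definition matches :: "(nat \<Rightarrow> nat) \<Rightarrow> nat \<Rightarrow> nat \<Rightarrow> bool" where
  "matches f m j \<longleftrightarrow> (\<forall>i<m. f i = of_bool (i \<in> set_decode j))"

lemma matches_char_fun: "matches (char_fun X) m j \<longleftrightarrow> (\<forall>i<m. X i = (i \<in> set_decode j))"
  by (auto simp: matches_def char_fun_def)

definition string_code :: "nat \<Rightarrow> nat \<Rightarrow> nat" where
  "string_code j m = list_encode (map (\<lambda>i. of_bool (i \<in> set_decode j)) [0..<m])"

lemma in_cylinder_string_code: "in_cylinder f (string_code j m) \<longleftrightarrow> matches f m j"
  unfolding string_code_def in_cylinder_list_encode matches_def by auto

lemma recfn_string_code:
  assumes "recfn J" "recfn M"
  shows "recfn (\<lambda>X x. string_code (J X x) (M X x))"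
proof -
  \<comment> \<open>The list grows from the right: step \<open>k\<close> prepends the bit at
    position \<open>m - Suc k\<close>.\<close>
  have "rec_nat 0 (\<lambda>k y. Suc (prod_encode (of_bool (m - Suc k \<in> set_decode j), y))) k =
      list_encode (map (\<lambda>i. of_bool (i \<in> set_decode j)) [m - k..<m])" if "k \<le> m" for j m k
    using that
  proof (induction k)
    case (Suc k)
    then have "[m - Suc k..<m] = (m - Suc k) # [m - k..<m]"
      by (metis Suc_diff_Suc Suc_le_eq diff_less upt_conv_Cons zero_less_Suc less_le_trans)
    with Suc show ?case by simp
  qed simp
  from this[of m m for m] have "rec_nat 0 (\<lambda>k y. Suc (prod_encode (of_bool (m - Suc k \<in> set_decode j), y))) m =
      string_code j m" for j m
    by (simp add: string_code_def)
  moreover have "recfn (\<lambda>X x. rec_nat 0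
      (\<lambda>k y. Suc (prod_encode (of_bool (M X x - Suc k \<in> set_decode (J X x)), y))) (M X x))"
    by (intro recfn_intros assms recfn_comp[OF assms(1)] recfn_comp[OF assms(2)])
  ultimately show ?thesis by (simp only:)
qed

lemma recfn_stage: "recfn A \<Longrightarrow> recfn B \<Longrightarrow> recfn (\<lambda>X x. stage (A X x) (B X x))"
proof -
  assume AB: "recfn A" "recfn B"
  have "recfn (\<lambda>X z. stage (\<pi>1 z) (\<pi>2 z))"
    unfolding stage_def by (intro recfn_intros decfn_conv0)
  from recfn_comp2[where F = "\<lambda>_. stage", OF this AB] show ?thesis .
qed

section \<open>The waiting functional and its domains\<close>

definition waits :: "nat \<Rightarrow> (nat \<Rightarrow> nat) \<Rightarrow> nat \<Rightarrow> bool" where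
  "waits b f x \<longleftrightarrow> \<pi>2 (stage (\<pi>1 x) (\<pi>2 x)) = \<pi>2 x \<and>
     matches f (Suc (\<pi>1 x + b)) (\<pi>1 (stage (\<pi>1 x) (\<pi>2 x)))"

text \<open>A halting witness exceeds the computed value, so it can serve as the output. Where
  nothing is awaited every \<open>s\<close> qualifies, and the least search returns 0 at
  once.\<close>

definition escapes :: "nat \<Rightarrow> (nat \<Rightarrow> nat) \<Rightarrow> nat \<Rightarrow> nat \<Rightarrow> bool" where
  "escapes b f x s \<longleftrightarrow> (waits b f x \<longrightarrow> conv (\<lambda>_. 0) (\<pi>1 x) x s)"

lemma decfn_escapes: "decfn (\<lambda>X z. escapes (\<pi>1 (\<pi>1 z)) X (\<pi>2 (\<pi>1 z)) (\<pi>2 z))"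
  unfolding escapes_def waits_def matches_def
  by (intro recfn_intros recfn_stage decfn_conv0)

lemma not_computably_dominated_escapes:
  assumes f: "f = char_fun X" and G: "\<And>x. escapes b f x (G x)"
  shows "\<not> computably_dominated G"
proof
  assume "computably_dominated G"
  then obtain g where "computable g" and le: "\<And>k. G k \<le> g k"
    unfolding computably_dominated_def by blast
  then obtain e where e: "\<And>x. Phi e (\<lambda>_. 0) x (g x)"
    unfolding computable_def computable_in_def Phi_total_def by blast
  then obtain q where q: "prog_index q = e" unfolding Phi_def by blast
  with e have eval_g: "eval (\<lambda>_. 0) q x (g x)" for x
    using Phi_prog_index by blast
  have "\<exists>s. conv (\<lambda>_. 0) e x s" for x
    using eval_g conv_complete q by blast
  \<comment> \<open>The part chosen is the one containing \<open>X\<close>, so \<open>X\<close> is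
    waiting at \<open>(e, n)\<close>.\<close>
  then obtain n where n: "stage e n = prod_encode (segment X (Suc (e + b)), n)"
    using stage_reaches_all by blast
  define x where "x = prod_encode (e, n)"
  have "waits b f x"
    unfolding waits_def x_def f by (simp add: n matches_char_fun set_decode_segment)
  with G[of x] have conv: "conv (\<lambda>_. 0) e x (G x)"
    unfolding escapes_def x_def by simp
  from conv_sound[of "\<lambda>_. 0" q] conv have "eval (\<lambda>_. 0) q x (\<pi>2 (G x))"
    unfolding q by blast
  then have "g x = \<pi>2 (G x)" using eval_g eval_deterministic by blast
  with conv_value_less[OF conv] le[of x] show False by simp
qed

text \<open>The class requires that no \<open>x\<close> causes an endless wait. For an
  \<open>x\<close> at which some part starts, the opposite event is the Pi^0_1 class
  \<open>d b x\<close>: the complement of the part is removed, and the whole space too once the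
  computation halts. The indices are computable by \<open>smn\<close>.\<close>

lemma uniformly_Pi_2_escapes:
  "uniformly_Pi 2 (\<lambda>b. {f. \<forall>x. \<exists>s. escapes b f x s})"
proof -
  define l where "l b x = string_code (\<pi>1 (stage (\<pi>1 x) (\<pi>2 x))) (Suc (\<pi>1 x + b))" for b x
  have l: "recfn (\<lambda>X z. l (A X z) (B X z))" if "recfn A" "recfn B" for A B
    unfolding l_def by (intro recfn_string_code recfn_stage recfn_intros that)
  \<comment> \<open>Index \<open>0\<close> is the cylinder of the empty string, i.e. the whole space.\<close>
  define P where "P f y s \<longleftrightarrow> \<pi>2 y = 0 \<and> conv (\<lambda>_. 0) (\<pi>1 (\<pi>2 (\<pi>1 y))) (\<pi>2 (\<pi>1 y)) s \<or>
      \<pi>2 y = 3 * (3 * l (\<pi>1 (\<pi>1 y)) (\<pi>2 (\<pi>1 y))) + 1" for f :: "nat \<Rightarrow> nat" and y s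
  have "decfn (\<lambda>X z. P X (\<pi>1 z) (\<pi>2 z))"
    unfolding P_def by (intro recfn_intros decfn_conv0 l)
  from search_prog[where P = P, OF this] obtain r where
    r: "\<And>X y s. eval X r y s \<longleftrightarrow> P X y s \<and> (\<forall>m<s. \<not> P X y m)"
    by blast
  define d where "d b x = prog_index (smn r (prod_encode (b, x)))" for b x
  have ce_d: "c \<in> ce_set (\<lambda>_. 0) (d b x) \<longleftrightarrow>
      (c = 0 \<and> (\<exists>s. conv (\<lambda>_. 0) (\<pi>1 x) x s)) \<or> c = 3 * (3 * l b x) + 1" for b x c
    unfolding ce_set_def d_def mem_Collect_eq Phi_prog_index eval_smn
      search_prog_halts[of r P, OF r] by (auto simp: P_def[abs_def])
  have all: "f \<in> Pi_class 0 0" for f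
    using Pi_class_0_simps(1)[of f 0] by (simp add: in_cylinder_def del: Pi_class.simps)
  have Pi_Suc: "f \<in> Pi_class (Suc n) e \<longleftrightarrow> (\<forall>c. c \<in> ce_set (\<lambda>_. 0) e \<longrightarrow> f \<notin> Pi_class n c)" for f n e
    unfolding Pi_class.simps(2) by blast
  have Pi_d: "f \<in> Pi_class (Suc 0) (d b x) \<longleftrightarrow>
      \<not> (\<exists>s. conv (\<lambda>_. 0) (\<pi>1 x) x s) \<and> in_cylinder f (l b x)" for f b x
  proof -
    have "f \<in> Pi_class (Suc 0) (d b x) \<longleftrightarrow>
        \<not> (\<exists>s. conv (\<lambda>_. 0) (\<pi>1 x) x s) \<and> f \<notin> Pi_class 0 (3 * (3 * l b x) + 1)"
      unfolding Pi_Suc ce_d using all[of f] by blast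
    then show ?thesis by (simp only: Pi_class_0_simps not_not)
  qed
  define Q where "Q f y x \<longleftrightarrow> \<pi>2 y = d (\<pi>1 y) x \<and> \<pi>2 (stage (\<pi>1 x) (\<pi>2 x)) = \<pi>2 x"
    for f :: "nat \<Rightarrow> nat" and y x
  have "decfn (\<lambda>X z. Q X (\<pi>1 z) (\<pi>2 z))"
    unfolding Q_def d_def by (intro recfn_intros recfn_smn recfn_stage)
  from search_prog[where P = Q, OF this] obtain t where
    t: "\<And>X y x. eval X t y x \<longleftrightarrow> Q X y x \<and> (\<forall>m<x. \<not> Q X y m)"
    by blast
  define h where "h b = prog_index (smn t b)" for b
  have ce_h: "c \<in> ce_set (\<lambda>_. 0) (h b) \<longleftrightarrow> (\<exists>x. c = d b x \<and> \<pi>2 (stage (\<pi>1 x) (\<pi>2 x)) = \<pi>2 x)" for b c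
    unfolding ce_set_def h_def mem_Collect_eq Phi_prog_index eval_smn
      search_prog_halts[of t Q, OF t] by (simp add: Q_def[abs_def])
  have "{f. \<forall>x. \<exists>s. escapes b f x s} = Pi_class 2 (h b)" for b
  proof -
    have "f \<in> Pi_class 2 (h b) \<longleftrightarrow>
        (\<forall>x. \<pi>2 (stage (\<pi>1 x) (\<pi>2 x)) = \<pi>2 x \<longrightarrow> f \<notin> Pi_class (Suc 0) (d b x))" for f
      unfolding numeral_2_eq_2 Pi_Suc[of f "Suc 0"] ce_h by blast
    also have "\<dots> f \<longleftrightarrow> (\<forall>x. \<exists>s. escapes b f x s)" for f
    proof (rule all_cong1)
      fix x
      show "(\<pi>2 (stage (\<pi>1 x) (\<pi>2 x)) = \<pi>2 x \<longrightarrow> f \<notin> Pi_class (Suc 0) (d b x)) \<longleftrightarrow>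
          (\<exists>s. escapes b f x s)"
        unfolding Pi_d escapes_def waits_def l_def in_cylinder_string_code by meson
    qed
    finally show ?thesis by blast
  qed
  moreover have "computable h"
    unfolding h_def by (intro recfn_imp_computable recfn_smn recfn_intros)
  ultimately show ?thesis
    unfolding uniformly_Pi_def by blast
qed

text \<open>By \<open>stuck_unique\<close> each \<open>e\<close> contributes at most one cylinder,
  of measure \<open>(1/2) ^ (e + b + 1)\<close>, and these sum to \<open>(1/2) ^ b\<close>.\<close>

lemma martin_loef_test_stuck:
  "martin_loef_test (char_fun halting_problem)
     (\<lambda>b. {X. \<exists>e n. stuck e n \<and> matches (char_fun X) (Suc (e + b)) (\<pi>1 (stage e n))})"
  (is "martin_loef_test ?Z ?U")
proof -
  \<comment> \<open>\<open>halting_problem\<close> is the diagonal set. The program \<open>k\<close>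
    reads only the first component of its argument, so \<open>smn k x\<close> halts on its own index
    if and only if the computation awaited at \<open>x\<close> halts.\<close>
  have "decfn (\<lambda>X z. conv (\<lambda>_. 0) (\<pi>1 (\<pi>1 (\<pi>1 z))) (\<pi>1 (\<pi>1 z)) (\<pi>2 z))"
    by (intro recfn_intros decfn_conv0)
  from search_prog[where P = "\<lambda>X y s. conv (\<lambda>_. 0) (\<pi>1 (\<pi>1 y)) (\<pi>1 y) s", OF this]
  obtain k where k: "\<And>X y s. eval X k y s \<longleftrightarrow> conv (\<lambda>_. 0) (\<pi>1 (\<pi>1 y)) (\<pi>1 y) s \<and>
      (\<forall>m<s. \<not> conv (\<lambda>_. 0) (\<pi>1 (\<pi>1 y)) (\<pi>1 y) m)"
    by blast
  have Z: "?Z (prog_index (smn k x)) = 0 \<longleftrightarrow> (\<forall>s. \<not> conv (\<lambda>_. 0) (\<pi>1 x) x s)" for x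
    using search_prog_halts[of k, OF k, of "\<lambda>_. 0" "prod_encode (x, prog_index (smn k x))"]
    unfolding char_fun_def halting_problem_def ce_set_def mem_Collect_eq Phi_prog_index eval_smn
    by simp
  define P where "P f y x \<longleftrightarrow> \<pi>2 (stage (\<pi>1 x) (\<pi>2 x)) = \<pi>2 x \<and> f (prog_index (smn k x)) = 0 \<and>
      \<pi>2 y = string_code (\<pi>1 (stage (\<pi>1 x) (\<pi>2 x))) (Suc (\<pi>1 x + \<pi>1 y))" for f :: "nat \<Rightarrow> nat" and y x
  have "decfn (\<lambda>X z. P X (\<pi>1 z) (\<pi>2 z))"
    unfolding P_def by (intro recfn_intros recfn_stage recfn_smn recfn_string_code)
  from search_prog[where P = P, OF this] obtain q where
    q: "\<And>X y x. eval X q y x \<longleftrightarrow> P X y x \<and> (\<forall>m<x. \<not> P X y m)"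
    by blast
  have P_Z: "(\<exists>x. P ?Z (prod_encode (b, c)) x) \<longleftrightarrow>
      (\<exists>e n. stuck e n \<and> c = string_code (\<pi>1 (stage e n)) (Suc (e + b)))" for b c
  proof
    assume "\<exists>x. P ?Z (prod_encode (b, c)) x"
    then obtain x where "P ?Z (prod_encode (b, c)) x" ..
    then show "\<exists>e n. stuck e n \<and> c = string_code (\<pi>1 (stage e n)) (Suc (e + b))"
      unfolding P_def stuck_def Z by (intro exI[of _ "\<pi>1 x"] exI[of _ "\<pi>2 x"]) simp
  next
    assume "\<exists>e n. stuck e n \<and> c = string_code (\<pi>1 (stage e n)) (Suc (e + b))"
    then obtain e n where "stuck e n" "c = string_code (\<pi>1 (stage e n)) (Suc (e + b))" by blast
    then show "\<exists>x. P ?Z (prod_encode (b, c)) x"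
      unfolding P_def stuck_def Z by (intro exI[of _ "prod_encode (e, n)"]) simp
  qed
  have string: "list_encode (map (char_fun X) [0..<i]) = string_code j m \<longleftrightarrow> i = m \<and> matches (char_fun X) m j"
    for X i j m
    unfolding string_code_def list_encode_eq matches_def list_eq_iff_nth_eq by auto
  have "?U = Sigma1_seq ?Z (prog_index q)"
  proof (intro ext set_eqI)
    fix b X
    have "X \<in> Sigma1_seq ?Z (prog_index q) b \<longleftrightarrow>
        (\<exists>i. \<exists>x. P ?Z (prod_encode (b, list_encode (map (char_fun X) [0..<i]))) x)"
      unfolding Sigma1_seq_def ce_set_def mem_Collect_eq Phi_prog_index
      using search_prog_halts[of q P, OF q] by simp
    then show "X \<in> ?U b \<longleftrightarrow> X \<in> Sigma1_seq ?Z (prog_index q) b"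
      unfolding P_Z string by blast
  qed
  moreover have "emeasure fair_coin (?U b) \<le> ennreal ((1/2) ^ b)" for b
  proof -
    define C where "C e = {X. \<exists>n. stuck e n \<and> matches (char_fun X) (Suc (e + b)) (\<pi>1 (stage e n))}" for e
    have C: "C e \<in> sets fair_coin \<and> emeasure fair_coin (C e) \<le> ennreal ((1/2) ^ (e + Suc b))" for e
    proof (cases "\<exists>n. stuck e n")
      case True
      then obtain n where n: "stuck e n" ..
      then have "C e = {X. \<forall>i<Suc (e + b). X i = (i \<in> set_decode (\<pi>1 (stage e n)))}"
        using stuck_unique[OF n] unfolding C_def matches_char_fun by blast
      then show ?thesis
        using emeasure_fair_coin_cylinder sets_fair_coin_cylinder by simp
    next
      case False
      then have "C e = {}" unfolding C_def by blast
      then show ?thesis by simp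
    qed
    have "?U b = (\<Union>e. C e)" unfolding C_def by blast
    then have "emeasure fair_coin (?U b) \<le> (\<Sum>e. emeasure fair_coin (C e))"
      using emeasure_subadditive_countably[of C fair_coin] C by (simp add: image_subset_iff)
    also have "\<dots> \<le> (\<Sum>e. ennreal ((1/2) ^ (e + Suc b)))"
      using C by (intro suminf_le) auto
    also have "\<dots> = ennreal ((1/2) ^ b)"
      by (rule suminf_half_powers)
    finally show ?thesis .
  qed
  ultimately show ?thesis
    unfolding martin_loef_test_def by blast
qed

text \<open>A sequence outside component \<open>b\<close> of the test never waits forever under
  parameter \<open>b\<close>, so this \<open>b\<close> names a class containing it.\<close>

lemma reducible_fin_2: "reducible_fin 2 non_computably_dominated two_randoms"
proof -
  define V where "V b = {f. \<forall>x. \<exists>s. escapes b f x s}" for b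
  from search_prog[where P = "\<lambda>X y s. escapes (\<pi>1 y) X (\<pi>2 y) s", OF decfn_escapes]
  obtain p where p: "\<And>X y s. eval X p y s \<longleftrightarrow> escapes (\<pi>1 y) X (\<pi>2 y) s \<and>
      (\<forall>m<s. \<not> escapes (\<pi>1 y) X (\<pi>2 y) m)"
    by blast
  have cover: "two_randoms \<subseteq> (\<Union>b. V b)"
  proof
    fix f assume "f \<in> two_randoms"
    then obtain X where f: "f = char_fun X" and X: "martin_loef_random (char_fun halting_problem) X"
      unfolding two_randoms_def two_random_def by blast
    from X martin_loef_test_stuck obtain b where b:
      "\<not> (\<exists>e n. stuck e n \<and> matches (char_fun X) (Suc (e + b)) (\<pi>1 (stage e n)))"
      unfolding martin_loef_random_def by blast
    have "\<exists>s. escapes b f x s" for x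
    proof (rule ccontr)
      assume "\<nexists>s. escapes b f x s"
      then have "waits b f x" "\<forall>s. \<not> conv (\<lambda>_. 0) (\<pi>1 x) x s"
        unfolding escapes_def by blast+
      then have "stuck (\<pi>1 x) (\<pi>2 x) \<and> matches (char_fun X) (Suc (\<pi>1 x + b)) (\<pi>1 (stage (\<pi>1 x) (\<pi>2 x)))"
        unfolding stuck_def waits_def f by simp
      with b show False by blast
    qed
    then show "f \<in> (\<Union>b. V b)" unfolding V_def by blast
  qed
  have red: "\<exists>g\<in>non_computably_dominated. Phi_total (prog_index (smn p b)) f g"
    if "f \<in> two_randoms \<inter> V b" for b f
  proof -
    from that obtain X where X: "f = char_fun X" unfolding two_randoms_def by blast
    have "\<exists>s. eval f (smn p b) x s" for x
      using that search_prog_halts[of p, OF p, of f "prod_encode (b, x)"]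
      unfolding eval_smn V_def by simp
    then obtain G where G: "\<And>x. eval f (smn p b) x (G x)" by metis
    then have "escapes b f x (G x)" for x
      unfolding eval_smn p by simp
    from not_computably_dominated_escapes[OF X this] G show ?thesis
      unfolding non_computably_dominated_def Phi_total_def Phi_prog_index by blast
  qed
  have "computable (\<lambda>b. prog_index (smn p b))"
    by (intro recfn_imp_computable recfn_smn recfn_intros)
  moreover have "uniformly_Pi 2 V"
    using uniformly_Pi_2_escapes unfolding V_def .
  ultimately show ?thesis
    using cover red unfolding reducible_fin_def by blast
qed

theorem theorem5p8:
  "uniformity_level non_computably_dominated two_randoms = 2 \<and>
   reducible 2 non_computably_dominated two_randoms \<and>
   \<not> reducible 0 non_computably_dominated two_randoms \<and>
   \<not> reducible 1 non_computably_dominated two_randoms"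
proof -
  have r2: "reducible 2 non_computably_dominated two_randoms"
    using reducible_fin_2 by (simp add: reducible_def numeral_eq_enat)
  have low: "\<not> reducible (enat n) non_computably_dominated two_randoms" if "n \<le> 1" for n
    using not_reducible_fin_0_1[OF that] by (simp add: reducible_def)
  have "uniformity_level non_computably_dominated two_randoms = 2"
    unfolding uniformity_level_def
  proof (rule Least_equality[where P = "\<lambda>n. reducible n non_computably_dominated two_randoms", OF r2])
    fix n assume n: "reducible n non_computably_dominated two_randoms"
    show "2 \<le> n"
    proof (cases n)
      case (enat m)
      with low n have "\<not> m \<le> 1" by blast
      with enat show ?thesis by (simp add: numeral_eq_enat)
    qed simp
  qed
  with r2 low[of 0] low[of 1] show ?thesis
    by (simp add: zero_enat_def one_enat_def)
qed

end
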